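(* Let $\lambda=(\pi_1,\dots,\pi_{l})$ be a number partition of $n$ such that the pair $(\lambda,\pi_1)$ satisfies the Cutting Condition. (a) If $\pi_1$ is involved in a trivial resonance (i.e. $\pi_1=\pi_i$ for some $2\leq i\leq l$), then $\delta_\lambda$ is contractible, and hence so is $\widehat{\mathrm{Hyp}^n_\lambda}$. (b) If $\pi_1\neq\pi_i$ for $i=2,\dots,l$, then there exists an acyclic matching on $D_\lambda$ such that the nontrivial critical simplices are exactly those indexed by the compositions $a=[\alpha_1,\dots,\alpha_{m}]\in D_\lambda$ with $\alpha_{m}=\pi_1$ and $\alpha_i\neq\pi_1+\sum_{j\in I}\pi_j$ for all $1\leq i\leq m-1$ and all (possibly empty) $I\subseteq\{2,\dots,l\}$.
   Context: A composition of $n$ is an ordered tuple $[a_1,\dots,a_l]$ of positive integers with sum $n$ (blocks $a_i$, length $l$); a number partition of $n$ is such a tuple unordered, written $(a_1,\dots,a_l)$; the type of a composition is its underlying number partition. Compositions are ordered by $[a_1,\dots,a_p]\leq[b_1,\dots,b_q]$ iff there are $0=i_0<\dots<i_p=q$ with $a_j=b_{i_{j-1}+1}+\dots+b_{i_j}$. For a number partition $\lambda$ of $n$, $D_\lambda$ is the poset of compositions of $n$ that are $\leq$ some composition of type $\lambda$, and $\delta_\lambda$ is the simplicial complex whose face poset (empty face included) is $D_\lambda$ (composition of length $l$ $\leftrightarrow$ $(l-2)$-simplex, $[n]$ $\leftrightarrow$ empty simplex). A resonance of a composition $[\pi_1,\dots,\pi_l]$ is an unordered pair of nonempty disjoint $I,J\subseteq\{1,\dots,l\}$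 with $\sum_I\pi_i=\sum_J\pi_j$; trivial if $|I|=|J|=1$. Number partitions of $n$ are ordered by refinement: $\lambda=(\pi_1,\dots,\pi_{l(\lambda)})\geq\mu=(\eta_1,\dots,\eta_{l(\mu)})$ iff $\{1,\dots,l(\lambda)\}$ is a disjoint union of sets $I_1,\dots,I_{l(\mu)}$ with $\sum_{j\in I_k}\pi_j=\eta_k$ for all $k$. Cutting Condition: $(\lambda,\pi_1)$ satisfies it if whenever $\mu=(\eta_1,\dots,\eta_{l(\mu)})\leq\lambda$ and for some $i$ and some nonempty $I\subseteq\{2,\dots,l(\lambda)\}$ we have $\eta_i=\pi_1+\sum_{j\in I}\pi_j$, then $\lambda\geq(\eta_1,\dots,\eta_{i-1},\pi_1,\sum_{j\in I}\pi_j,\eta_{i+1},\dots,\eta_{l(\mu)})$. Discrete Morse theory: a matching on the face poset $P$ (with empty face) is a set of disjoint pairs $(\sigma,\tau)$ with $\tau$ covering $\sigma$; writing $W(\sigma)=\tau$, it is acyclic if there is no sequence $\sigma_0,\dots,\sigma_s$ of matched lower elements with $\sigma_0\neq\sigma_1$, $\sigma_0=\sigma_s$ and $W(\sigma_i)$ covering $\sigma_{i+1}$ for all $i$. A nontrivial critical cell is a cell not belonging to any pair of the matching. $\widehat{\mathrm{Hyp}^n_\lambda}$ is the one-point compactification of the closure in the space of monic degree-$n$ real-rooted polynomials of the set of polynomials $\prod_{i}(x-r_i)^{\alpha_i}$, $r_1<\dots<r_s$, $[\alpha_1,\dots,\alpha_s]$ of type $\lambda$; it is homeomorphic to the double suspension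 of $\delta_\lambda$. *)

theory Defs
  imports "HOL-Analysis.Analysis" "HOL-Computational_Algebra.Polynomial" "HOL-Library.Multiset"
begin

section \<open>Compositions and number partitions\<close>

definition composition :: "nat \<Rightarrow> nat list \<Rightarrow> bool" where
  "composition n a \<longleftrightarrow> (\<forall>x\<in>set a. 0 < x) \<and> sum_list a = n"

text \<open>Number partitions are multisets, so the type of a composition \<open>a\<close> is \<open>mset a\<close>.\<close>

definition number_partition :: "nat \<Rightarrow> nat multiset \<Rightarrow> bool" where
  "number_partition n L \<longleftrightarrow> (\<forall>x\<in>#L. 0 < x) \<and> sum_mset L = n"

definition comp_le :: "nat list \<Rightarrow> nat list \<Rightarrow> bool" where
  "comp_le a b \<longleftrightarrow>
    (\<exists>i :: nat \<Rightarrow> nat. i 0 = 0 \<and> i (length a) = length b \<and>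
       (\<forall>j<length a. i j < i (Suc j) \<and> a ! j = (\<Sum>k = i j..<i (Suc j). b ! k)))"

text \<open>\<open>refines L M\<close> is \<open>L \<ge> M\<close> in the refinement order. The choice of the
  enumerations \<open>p\<close> and \<open>e\<close> of the two multisets is immaterial.\<close>

definition refines :: "nat multiset \<Rightarrow> nat multiset \<Rightarrow> bool" where
  "refines L M \<longleftrightarrow>
    (\<exists>p e. mset p = L \<and> mset e = M \<and>
       (\<exists>I :: nat \<Rightarrow> nat set.
          disjoint_family_on I {..<length e} \<and> (\<Union>k<length e. I k) = {..<length p} \<and>
          (\<forall>k<length e. (\<Sum>j\<in>I k. p ! j) = e ! k)))"

text \<open>In the following, a number partition with distinguished part \<open>\<pi>\<^sub>1\<close> is given by a
  list \<open>p\<close> enumerating its parts with \<open>p ! 0 = \<pi>\<^sub>1\<close>; list positions start at 0, so the indices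
  \<open>2, \<dots>, l\<close> of the remaining parts become \<open>1, \<dots>, length p - 1\<close>.\<close>

definition cutting_condition :: "nat list \<Rightarrow> bool" where
  "cutting_condition p \<longleftrightarrow>
    (\<forall>e i I. number_partition (sum_list p) (mset e) \<longrightarrow> refines (mset p) (mset e) \<longrightarrow>
       i < length e \<longrightarrow> I \<subseteq> {1..<length p} \<longrightarrow> I \<noteq> {} \<longrightarrow>
       e ! i = p ! 0 + (\<Sum>j\<in>I. p ! j) \<longrightarrow>
       refines (mset p) (mset (take i e @ [p ! 0, \<Sum>j\<in>I. p ! j] @ drop (Suc i) e)))"

text \<open>A resonance is an unordered pair; it is encoded as a symmetric relation in \<open>I\<close> and \<open>J\<close>.\<close>

definition resonance :: "nat list \<Rightarrow> nat set \<Rightarrow> nat set \<Rightarrow> bool" where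
  "resonance p I J \<longleftrightarrow>
    I \<subseteq> {..<length p} \<and> J \<subseteq> {..<length p} \<and> I \<noteq> {} \<and> J \<noteq> {} \<and> I \<inter> J = {} \<and>
    (\<Sum>i\<in>I. p ! i) = (\<Sum>j\<in>J. p ! j)"

definition trivial_resonance :: "nat list \<Rightarrow> nat set \<Rightarrow> nat set \<Rightarrow> bool" where
  "trivial_resonance p I J \<longleftrightarrow> resonance p I J \<and> card I = 1 \<and> card J = 1"


section \<open>The poset \<open>D\<^sub>\<lambda>\<close> and the complex \<open>\<delta>\<^sub>\<lambda>\<close>\<close>

definition D_poset :: "nat multiset \<Rightarrow> nat list set" where
  "D_poset L = {a. composition (sum_mset L) a \<and> (\<exists>b. mset b = L \<and> comp_le a b)}"

text \<open>A composition of \<open>n\<close> of length \<open>l\<close> is identified with the \<open>(l - 1)\<close>-element set of its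
  proper partial sums, a subset of \<open>{1, \<dots>, n - 1}\<close>; the order of compositions becomes
  inclusion of sets (see \<open>comp_le_iff_cuts\<close> and \<open>card_cuts\<close> below), so that \<open>delta L\<close>, as a set of
  faces including the empty one, is the simplicial complex with face poset \<open>D_poset L\<close>.\<close>

definition cuts :: "nat list \<Rightarrow> nat set" where
  "cuts a = (\<lambda>k. \<Sum>j<k. a ! j) ` {0<..<length a}"

definition delta :: "nat multiset \<Rightarrow> nat set set" where
  "delta L = cuts ` D_poset L"

text \<open>Points of the geometric realization are given by barycentric coordinates. The product topology
  on \<open>nat \<Rightarrow> real\<close> yields the usual topology of the realization of a finite complex.\<close>

definition geometric_realization :: "nat set set \<Rightarrow> (nat \<Rightarrow> real) topology" where
  "geometric_realization K =
    top_of_set {x. (\<forall>v. 0 \<le> x v) \<and> {v. x v \<noteq> 0} \<in> K \<and> (\<Sum>v | x v \<noteq> 0. x v) = 1}"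

lemma composition_psum_less:
  assumes "composition n a" "j < k" "k \<le> length a"
  shows "(\<Sum>i<j. a ! i) < (\<Sum>i<k. a ! i)"
proof -
  have pos: "0 < a ! i" if "i < length a" for i
    using assms(1) that by (simp add: composition_def)
  have "(\<Sum>i<k. a ! i) = (\<Sum>i<j. a ! i) + (\<Sum>i=j..<k. a ! i)"
    using assms(2) sum.atLeastLessThan_concat[of 0 j k "(!) a"] by (simp add: atLeast0LessThan)
  moreover have "0 < (\<Sum>i=j..<k. a ! i)"
    using assms pos by (intro sum_pos) auto
  ultimately show ?thesis by simp
qed

lemma card_cuts:
  assumes "composition n a"
  shows "card (cuts a) = length a - 1"
proof -
  have "inj_on (\<lambda>k. \<Sum>j<k. a ! j) {0<..<length a}"
    by (rule linorder_inj_onI')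
      (use composition_psum_less[OF assms] in \<open>auto simp: less_imp_neq\<close>)
  then show ?thesis by (simp add: cuts_def card_image)
qed

lemma comp_le_iff_cuts:
  assumes a: "composition n a" and b: "composition n b"
  shows "comp_le a b \<longleftrightarrow> cuts a \<subseteq> cuts b"
proof
  have tot: "(\<Sum>j<length c. c ! j) = n" if "composition n c" for c
    using that by (simp add: composition_def sum_list_sum_nth atLeast0LessThan)
  show "cuts a \<subseteq> cuts b" if "comp_le a b"
  proof -
    obtain i where i0: "i 0 = 0" and il: "i (length a) = length b"
      and i: "\<And>j. j < length a \<Longrightarrow> i j < i (Suc j) \<and> a ! j = (\<Sum>k = i j..<i (Suc j). b ! k)"
      using \<open>comp_le a b\<close> unfolding comp_le_def by auto
    have s: "(\<Sum>j<k. a ! j) = (\<Sum>j<i k. b ! j)" if "k \<le> length a" for k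
      using that
    proof (induction k)
      case (Suc k)
      then have "i k < i (Suc k)" using i[of k] by simp
      then have "(\<Sum>j<i (Suc k). b ! j) = (\<Sum>j<i k. b ! j) + (\<Sum>j = i k..<i (Suc k). b ! j)"
        using sum.atLeastLessThan_concat[of 0 "i k" "i (Suc k)" "(!) b"]
        by (simp add: atLeast0LessThan)
      then show ?case using Suc i[of k] by simp
    qed (simp add: i0)
    have m: "i j < i k" if "j < k" "k \<le> length a" for j k
      using that
    proof (induction k)
      case (Suc k)
      then show ?case using i[of k] by (cases "j = k") auto
    qed simp
    show ?thesis
    proof
      fix x assume "x \<in> cuts a"
      then obtain k where k: "0 < k" "k < length a" "x = (\<Sum>j<k. a ! j)"
        by (auto simp: cuts_def)
      have "0 < i k" "i k < length b"
        using m[of 0 k] m[of k "length a"] k i0 il by auto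
      then show "x \<in> cuts b" using s[of k] k by (auto simp: cuts_def)
    qed
  qed
  show "comp_le a b" if sub: "cuts a \<subseteq> cuts b"
  proof -
    define S where "S c k = (\<Sum>j<k. c ! j)" for c :: "nat list" and k
    have "\<exists>i\<le>length b. S a k = S b i \<and> (k = 0 \<longrightarrow> i = 0) \<and> (k = length a \<longrightarrow> i = length b)"
      if kl: "k \<le> length a" for k
    proof -
      consider "k = 0" | "k = length a" "k \<noteq> 0" | "0 < k" "k < length a"
        using kl by linarith
      then show ?thesis
      proof cases
        case 1
        have "length b = 0" if "length a = 0"
        proof -
          have "n = 0" using that a by (simp add: composition_def)
          then have "\<not> 0 < length b"
            using composition_psum_less[OF b, of 0 "length b"] tot[OF b] by auto
          then show ?thesis by simp
        qed
        then show ?thesis using 1 by (intro exI[of _ 0]) (auto simp: S_def)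
      next
        case 2
        then show ?thesis using tot[OF a] tot[OF b] by (intro exI[of _ "length b"]) (simp add: S_def)
      next
        case 3
        then have "S a k \<in> cuts b" using sub by (auto simp: cuts_def S_def)
        then obtain i where "0 < i" "i < length b" "S a k = S b i" by (auto simp: cuts_def S_def)
        with 3 show ?thesis by (intro exI[of _ i]) auto
      qed
    qed
    then obtain i where i: "\<And>k. k \<le> length a \<Longrightarrow> i k \<le> length b \<and> S a k = S b (i k) \<and>
        (k = 0 \<longrightarrow> i k = 0) \<and> (k = length a \<longrightarrow> i k = length b)"
      by metis
    have "i j < i (Suc j) \<and> a ! j = (\<Sum>k = i j..<i (Suc j). b ! k)" if j: "j < length a" for j
    proof -
      have lt: "S b (i j) < S b (i (Suc j))"
        using composition_psum_less[OF a, of j "Suc j"] j i[of j] i[of "Suc j"] by (simp add: S_def)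
      have "i j < i (Suc j)"
      proof (rule ccontr)
        assume "\<not> ?thesis"
        then have "S b (i (Suc j)) \<le> S b (i j)" unfolding S_def by (intro sum_mono2) auto
        with lt show False by simp
      qed
      moreover have "S b (i (Suc j)) = S b (i j) + (\<Sum>k = i j..<i (Suc j). b ! k)"
        using sum.atLeastLessThan_concat[of 0 "i j" "i (Suc j)" "(!) b"] \<open>i j < i (Suc j)\<close>
        by (simp add: atLeast0LessThan S_def)
      moreover have "S a (Suc j) = S a j + a ! j" by (simp add: S_def)
      ultimately show ?thesis using i[of j] i[of "Suc j"] j by simp
    qed
    then show ?thesis unfolding comp_le_def using i[of 0] i[of "length a"] by (intro exI[of _ i]) auto
  qed
qed


section \<open>Acyclic matchings\<close>

definition covers :: "'a set \<Rightarrow> ('a \<Rightarrow> 'a \<Rightarrow> bool) \<Rightarrow> 'a \<Rightarrow> 'a \<Rightarrow> bool" where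
  "covers P le \<tau> \<sigma> \<longleftrightarrow> \<sigma> \<in> P \<and> \<tau> \<in> P \<and> le \<sigma> \<tau> \<and> \<sigma> \<noteq> \<tau> \<and>
     (\<forall>\<rho>\<in>P. le \<sigma> \<rho> \<longrightarrow> le \<rho> \<tau> \<longrightarrow> \<rho> = \<sigma> \<or> \<rho> = \<tau>)"

definition poset_matching :: "'a set \<Rightarrow> ('a \<Rightarrow> 'a \<Rightarrow> bool) \<Rightarrow> ('a \<times> 'a) set \<Rightarrow> bool" where
  "poset_matching P le M \<longleftrightarrow>
    (\<forall>(\<sigma>, \<tau>)\<in>M. covers P le \<tau> \<sigma>) \<and>
    (\<forall>(\<sigma>, \<tau>)\<in>M. \<forall>(\<sigma>', \<tau>')\<in>M. (\<sigma>, \<tau>) \<noteq> (\<sigma>', \<tau>') \<longrightarrow> {\<sigma>, \<tau>} \<inter> {\<sigma>', \<tau>'} = {})"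

text \<open>\<open>(\<sigma>, \<tau>) \<in> M\<close> means \<open>W(\<sigma>) = \<tau>\<close>.\<close>

definition acyclic_matching :: "'a set \<Rightarrow> ('a \<Rightarrow> 'a \<Rightarrow> bool) \<Rightarrow> ('a \<times> 'a) set \<Rightarrow> bool" where
  "acyclic_matching P le M \<longleftrightarrow>
    poset_matching P le M \<and>
    \<not> (\<exists>s \<sigma> \<tau>. 1 \<le> s \<and> (\<forall>i\<le>s. (\<sigma> i, \<tau> i) \<in> M) \<and> \<sigma> 0 \<noteq> \<sigma> (1::nat) \<and> \<sigma> 0 = \<sigma> s \<and>
         (\<forall>i<s. covers P le (\<tau> i) (\<sigma> (Suc i))))"

definition critical_cells :: "'a set \<Rightarrow> ('a \<times> 'a) set \<Rightarrow> 'a set" where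
  "critical_cells P M = {\<rho>\<in>P. \<forall>(\<sigma>, \<tau>)\<in>M. \<rho> \<noteq> \<sigma> \<and> \<rho> \<noteq> \<tau>}"


section \<open>Strata of real-rooted polynomials\<close>

text \<open>Polynomials of degree \<open>n\<close> carry the topology of their coefficients.\<close>

definition monic_real_rooted :: "nat \<Rightarrow> real poly topology" where
  "monic_real_rooted n =
    pullback_topology
      {f. degree f = n \<and> lead_coeff f = 1 \<and>
          (\<forall>z::complex. poly (map_poly complex_of_real f) z = 0 \<longrightarrow> z \<in> \<real>)}
      coeff euclidean"

definition stratum :: "nat multiset \<Rightarrow> real poly set" where
  "stratum L = {\<Prod>i<length \<alpha>. [:- (r ! i), 1:] ^ (\<alpha> ! i) | r \<alpha>.
     length r = length \<alpha> \<and> sorted_wrt (<) r \<and> mset \<alpha> = L}"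

definition Hyp_hat :: "nat \<Rightarrow> nat multiset \<Rightarrow> real poly option topology" where
  "Hyp_hat n L = Alexandroff_compactification
     (subtopology (monic_real_rooted n) (monic_real_rooted n closure_of stratum L))"

end

theory Submission
  imports Defs
begin

text \<open>
  Write \<open>\<pi>\<^sub>1 = p ! 0\<close>, \<open>B\<close> for the set of sums of subfamilies of the other parts, and \<open>A = \<pi>\<^sub>1 + B\<close>.
  Replace a composition by its set of cuts and mark the leftmost block whose size lies in \<open>A\<close>; such
  a block exists because one block contains the part \<open>\<pi>\<^sub>1\<close>. If the marked block is longer than
  \<open>\<pi>\<^sub>1\<close>, the Cutting Condition allows splitting off an initial \<open>\<pi>\<^sub>1\<close>; if it equals \<open>\<pi>\<^sub>1\<close> and is not
  last, merge it with its successor. These operations are mutually inverse and keep the mark, and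
  along a gradient path the mark moves strictly to the left, so this is an acyclic matching.
  If \<open>\<pi>\<^sub>1\<close> is repeated, no cell is critical, and \<open>\<delta>\<^sub>\<lambda>\<close> collapses to a point.

  An elementary collapse of the pair \<open>\<sigma> \<subset> \<sigma> \<union> {v}\<close> is realized by moving the minimal barycentric
  coordinate on \<open>\<sigma>\<close> over to \<open>v\<close>. The same formula applies to polynomials, for which the smallest
  root and the gaps between consecutive roots are coordinates: the closure of the stratum is the
  product of a line and the open cone over \<open>\<delta>\<^sub>\<lambda>\<close>, the deformation preserves the sum of the gaps,
  hence is proper, and so extends to the one-point compactification. What remains at the end is a
  closed half-plane, which is pushed to infinity.
\<close>

section \<open>Compositions and their cuts\<close>

text \<open>A composition does not record which of its blocks contains \<open>p ! 0\<close>.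
  Membership of a size in A depends on the composition alone, but a marked block need not be the one
  that holds this part in a given grouping. The merge still produces a size in A by an exchange: if
  one block has size \<open>p ! 0\<close> and another one contains the part, trading the two shows
  that the size of the other lies in \<open>B\<close>. The leftmost choice makes both moves
  invisible to the mark: nothing changes to its left, and a split leaves a block of size
  \<open>p ! 0\<close> at the same left end. The position of the mark is one potential with two
  uses, excluding cycles and finding a free face for each collapse, so contractibility is obtained
  without general theorems of discrete Morse theory. Likewise the compactified closure is contracted
  directly, not through a double suspension.\<close>

lemma cuts_Nil [simp]: "cuts [] = {}" and cuts_single [simp]: "cuts [x] = {}"
  by (auto simp: cuts_def)

lemma cuts_Cons:
  assumes "a \<noteq> []"
  shows "cuts (x # a) = insert x ((+) x ` cuts a)"
proof -
  have "k \<in> {0<..<length (x # a)} \<longleftrightarrow> k \<in> insert (Suc 0) (Suc ` {0<..<length a})" for k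
    using assms by (cases k) auto
  then have "{0<..<length (x # a)} = insert (Suc 0) (Suc ` {0<..<length a})"
    by blast
  then show ?thesis
    by (simp add: cuts_def image_image sum.lessThan_Suc_shift del: sum.lessThan_Suc)
qed

lemma cuts_append:
  assumes "u \<noteq> []" "v \<noteq> []"
  shows "cuts (u @ v) = cuts u \<union> {sum_list u} \<union> (+) (sum_list u) ` cuts v"
  using assms(1)
proof (induction u)
  case (Cons x u)
  show ?case
  proof (cases "u = []")
    case True
    then show ?thesis using assms(2) by (simp add: cuts_Cons)
  next
    case False
    then show ?thesis using Cons.IH by (auto simp: cuts_Cons image_Un image_image add.assoc)
  qed
qed simp

lemma cuts_split: "cuts (u @ x # y # v) = insert (sum_list u + x) (cuts (u @ (x + y) # v))"
proof (induction u)
  case Nil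
  show ?case by (cases "v = []") (auto simp: cuts_Cons image_image add.assoc)
next
  case (Cons z u)
  then show ?case by (auto simp: cuts_Cons image_image add.assoc)
qed

lemma composition_split:
  "composition n (u @ x # y # v) \<Longrightarrow> composition n (u @ (x + y) # v)"
  by (auto simp: composition_def)

lemma cuts_merge:
  assumes "composition n (u @ x # y # v)"
  shows "cuts (u @ (x + y) # v) = cuts (u @ x # y # v) - {sum_list u + x}"
proof -
  \<comment> \<open>Otherwise both compositions would have the same cuts, although their lengths
    differ by one.\<close>
  have "sum_list u + x \<notin> cuts (u @ (x + y) # v)"
  proof
    assume "sum_list u + x \<in> cuts (u @ (x + y) # v)"
    then have "cuts (u @ x # y # v) = cuts (u @ (x + y) # v)"
      by (auto simp: cuts_split)
    then show False
      using card_cuts[OF assms] card_cuts[OF composition_split[OF assms]] by simp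
  qed
  then show ?thesis by (auto simp: cuts_split)
qed

lemma sum_list_take_nth: "k \<le> length a \<Longrightarrow> sum_list (take k a) = (\<Sum>j<k. a ! j)"
  for a :: "nat list"
  by (simp add: sum_list_sum_nth atLeast0LessThan)

lemma composition_psum_length: "composition n a \<Longrightarrow> (\<Sum>j<length a. a ! j) = n"
  by (simp add: composition_def sum_list_sum_nth atLeast0LessThan)

lemma cuts_subset:
  assumes "composition n a"
  shows "cuts a \<subseteq> {0<..<n}"
  using composition_psum_less[OF assms, of 0] composition_psum_less[OF assms, of _ "length a"]
    composition_psum_length[OF assms]
  by (auto simp: cuts_def)

lemma comp_le_antisym:
  assumes "composition n a" "composition n b" "comp_le a b" "comp_le b a"
  shows "a = b"
proof -
  have c: "cuts a = cuts b"
    using assms comp_le_iff_cuts by blast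
  have "length a = length b"
  \<comment> \<open>The truncated \<open>length a - 1\<close> in \<open>card_cuts\<close> does not
    separate the empty list from a single block, so nonemptiness has to be settled first.\<close>
  proof (cases "n = 0")
    case True
    have "c = []" if "composition n c" for c
      using that True by (cases c) (auto simp: composition_def)
    then have "a = []" "b = []" using assms(1,2) by auto
    then show ?thesis by simp
  next
    case False
    have "c \<noteq> []" if "composition n c" for c
      using that False by (auto simp: composition_def)
    then have "a \<noteq> []" "b \<noteq> []" using assms(1,2) by auto
    then have "0 < length a" "0 < length b" by auto
    then show ?thesis using card_cuts[OF assms(1)] card_cuts[OF assms(2)] c
      by (metis Suc_diff_1)
  qed
  obtain i where i: "i 0 = 0" "i (length a) = length b"
      "\<And>j. j < length a \<Longrightarrow> i j < i (Suc j) \<and> a ! j = (\<Sum>k = i j..<i (Suc j). b ! k)"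
    using assms(3) unfolding comp_le_def by auto
  \<comment> \<open>A strictly increasing index map that fixes both ends is the identity: induction
    from the left bounds it from below, induction from the right from above.\<close>
  have ge: "i k \<ge> k" if "k \<le> length a" for k
    using that
  proof (induction k)
    case (Suc k)
    then show ?case using i(3)[of k] by simp
  qed simp
  have le: "i (length a - k) \<le> length a - k" if "k \<le> length a" for k
    using that
  proof (induction k)
    case 0
    then show ?case using i(2) \<open>length a = length b\<close> by simp
  next
    case (Suc k)
    then have "i (length a - Suc k) < i (Suc (length a - Suc k))" using i(3)[of "length a - Suc k"] by simp
    moreover have "Suc (length a - Suc k) = length a - k" using Suc.prems by simp
    ultimately show ?case using Suc by simp
  qed
  have eq: "i k = k" if "k \<le> length a" for k
    using ge[OF that] le[of "length a - k"] that by simp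
  show ?thesis
    using \<open>length a = length b\<close> i(3) eq by (intro nth_equalityI) auto
qed

lemma cuts_inject:
  assumes "composition n a" "composition n b" "cuts a = cuts b"
  shows "a = b"
  using assms comp_le_antisym comp_le_iff_cuts by blast

text \<open>Neighbouring cuts, with 0 and \<open>n\<close> as end points, so that
  \<open>y - x\<close> runs through the block sizes. Blocks can then be discussed for sets of cuts,
  without positions in a list.\<close>

definition consec :: "nat \<Rightarrow> nat set \<Rightarrow> nat \<Rightarrow> nat \<Rightarrow> bool" where
  "consec n C x y \<longleftrightarrow>
    x \<in> insert 0 C \<and> y \<in> insert n C \<and> x < y \<and> (\<forall>z\<in>C. \<not> (x < z \<and> z < y))"

lemma consec_cuts_iff:
  assumes a: "composition n a" and n: "0 < n"
  shows "consec n (cuts a) x y \<longleftrightarrow>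
    (\<exists>k<length a. x = sum_list (take k a) \<and> y = x + a ! k)"
proof -
  define S where "S k = (\<Sum>j<k. a ! j)" for k
  have mono: "S j < S k \<longleftrightarrow> j < k" if "j \<le> length a" "k \<le> length a" for j k
    using composition_psum_less[OF a, of j k] composition_psum_less[OF a, of k j] that
    by (cases j k rule: linorder_cases) (auto simp: S_def)
  have len: "0 < length a" using a n by (auto simp: composition_def)
  have c: "cuts a = S ` {0<..<length a}" by (simp add: cuts_def S_def[abs_def])
  have S0: "S 0 = 0" and Sn: "S (length a) = n"
    using composition_psum_length[OF a] by (simp_all add: S_def)
  have SS: "S (Suc k) = S k + a ! k" for k by (simp add: S_def)
  have "consec n (cuts a) x y \<longleftrightarrow> (\<exists>k<length a. x = S k \<and> y = S (Suc k))"
  proof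
    assume con: "consec n (cuts a) x y"
    have "insert 0 (cuts a) \<subseteq> S ` {..<length a}"
      using len S0 unfolding c by force
    then obtain j where j: "j < length a" "x = S j"
      using con unfolding consec_def by blast
    have "insert n (cuts a) \<subseteq> S ` {0<..length a}"
      using len Sn unfolding c by force
    then obtain k where "k \<in> {0<..length a}" "y = S k"
      using con unfolding consec_def by blast
    then have k: "0 < k" "k \<le> length a" "y = S k" by auto
    have jk: "j < k" using con j k mono[of j k] by (simp add: consec_def)
    have "k = Suc j"
    proof (rule ccontr)
      assume "k \<noteq> Suc j"
      then have "Suc j < k" using jk by simp
      then have "S (Suc j) \<in> cuts a" using k unfolding c by auto
      moreover have "x < S (Suc j)" "S (Suc j) < y"
        using mono[of j "Suc j"] mono[of "Suc j" k] \<open>Suc j < k\<close> j k by auto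
      ultimately show False using con by (auto simp: consec_def)
    qed
    then show "\<exists>k<length a. x = S k \<and> y = S (Suc k)" using j k by blast
  next
    assume "\<exists>k<length a. x = S k \<and> y = S (Suc k)"
    then obtain k where k: "k < length a" "x = S k" "y = S (Suc k)" by auto
    have 1: "x \<in> insert 0 (cuts a)" using k S0 unfolding c by (cases "k = 0") auto
    have 2: "y \<in> insert n (cuts a)" using k Sn unfolding c by (cases "Suc k = length a") auto
    have 3: "x < y" using k mono[of k "Suc k"] by simp
    have "\<not> (x < z \<and> z < y)" if z: "z \<in> cuts a" for z
    proof -
      from z obtain j where "j < length a" "z = S j" unfolding c by auto
      then show ?thesis using k mono[of k j] mono[of j "Suc k"] by auto
    qed
    then show "consec n (cuts a) x y" using 1 2 3 by (auto simp: consec_def)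
  qed
  also have "\<dots> \<longleftrightarrow> (\<exists>k<length a. x = sum_list (take k a) \<and> y = x + a ! k)"
    using SS by (auto simp: sum_list_take_nth S_def)
  finally show ?thesis .
qed

section \<open>Blocks as groups of parts\<close>

lemma cuts_concat_superset:
  assumes "\<forall>l\<in>set bs. l \<noteq> []"
  shows "cuts (map sum_list bs) \<subseteq> cuts (concat bs)"
  using assms
proof (induction bs)
  case (Cons l bs)
  show ?case
  proof (cases "bs = []")
    case False
    then have "concat bs \<noteq> []" using Cons.prems by (cases bs) auto
    then show ?thesis using Cons False by (auto simp: cuts_Cons cuts_append)
  qed simp
qed simp

text \<open>Cutting \<open>b\<close> at the index map of \<open>comp_le\<close> groups its entries
  into one multiset per block; conversely, listing each group in any order and concatenating gives a
  suitable \<open>b\<close>. This removes the auxiliary \<open>b\<close> together with its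
  irrelevant order.\<close>

lemma D_poset_iff:
  assumes L: "number_partition n L"
  shows "a \<in> D_poset L \<longleftrightarrow>
    composition n a \<and> (\<exists>Ms. a = map sum_mset Ms \<and> sum_list Ms = L)"
proof -
  have n: "sum_mset L = n" using L by (simp add: number_partition_def)
  have "\<exists>Ms. a = map sum_mset Ms \<and> sum_list Ms = L" if ab: "mset b = L" "comp_le a b" for b
  proof -
    obtain i where i: "i 0 = 0" "i (length a) = length b"
      "\<And>j. j < length a \<Longrightarrow> i j < i (Suc j) \<and> a ! j = (\<Sum>k = i j..<i (Suc j). b ! k)"
      using ab unfolding comp_le_def by auto
    define Ms where "Ms = map (\<lambda>j. mset (map ((!) b) [i j..<i (Suc j)])) [0..<length a]"
    have "sum_list (map (\<lambda>j. mset (map ((!) b) [i j..<i (Suc j)])) [0..<m]) =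
        mset (map ((!) b) [0..<i m])" if "m \<le> length a" for m
      using that
    proof (induction m)
      case (Suc m)
      have "i m < i (Suc m)" using i(3)[of m] Suc.prems by simp
      then have "[0..<i (Suc m)] = [0..<i m] @ [i m..<i (Suc m)]"
        using upt_add_eq_append[of 0 "i m" "i (Suc m) - i m"] by simp
      then show ?case using Suc by simp
    qed (simp add: i(1))
    from this[of "length a"] have "sum_list Ms = L"
      using ab i(2) by (simp add: Ms_def map_nth)
    moreover have "a = map sum_mset Ms"
      using i(3) by (intro nth_equalityI)
        (auto simp: Ms_def sum_mset_sum_list sum_list_distinct_conv_sum_set simp del: mset_map)
    ultimately show ?thesis by auto
  qed
  moreover have "\<exists>b. mset b = L \<and> comp_le a b"
    if a: "composition n a" "a = map sum_mset Ms" "sum_list Ms = L" for Ms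
  proof -
    obtain f :: "nat multiset \<Rightarrow> nat list" where f: "\<And>M. mset (f M) = M" by (metis ex_mset)
    define bs where "bs = map f Ms"
    have Ms: "Ms = map mset bs" by (simp add: bs_def f o_def)
    have ab: "a = map sum_list bs" by (simp add: a Ms sum_mset_sum_list)
    have L': "mset (concat bs) = L" using a Ms by (simp add: mset_concat)
    have cb: "composition n (concat bs)"
      using L unfolding number_partition_def L'[symmetric] composition_def
      by (simp add: sum_mset_sum_list)
    have "\<forall>l\<in>set bs. l \<noteq> []" using a(1) unfolding ab composition_def by auto
    then have "comp_le a (concat bs)"
      using comp_le_iff_cuts[OF a(1) cb] cuts_concat_superset ab by simp
    then show ?thesis using L' by blast
  qed
  ultimately show ?thesis by (auto simp: D_poset_def n)
qed

text \<open>Lets the groups of parts be permuted along with their sums, when only the multiset of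
  sums is prescribed.\<close>

lemma mset_eq_mset_map:
  assumes "mset a = mset (map f xs)"
  obtains ys where "mset ys = mset xs" "a = map f ys"
proof -
  have "\<exists>ys. mset ys = mset xs \<and> a = map f ys"
    using assms
  proof (induction a arbitrary: xs)
    case (Cons x a)
    then have "x \<in> set (map f xs)" by (metis list.set_intros(1) mset_eq_setD)
    then obtain z where "z \<in> set xs" "x = f z" by auto
    then obtain u v where xs: "xs = u @ z # v" by (metis split_list)
    then have "mset a = mset (map f (u @ v))" using Cons.prems \<open>x = f z\<close> by simp
    with Cons.IH obtain ys where "mset ys = mset (u @ v)" "a = map f ys" by blast
    then show ?case using xs \<open>x = f z\<close> by (intro exI[of _ "z # ys"]) simp
  qed simp
  then show ?thesis using that by blast
qed

text \<open>The bridge from the Cutting Condition, which speaks of unordered partitions, to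
  compositions: since the parts of \<open>L\<close> may be listed in any order, the blocks of a
  composition may be permuted without leaving \<open>D_poset L\<close>.\<close>

lemma refines_iff_D_poset:
  assumes L: "number_partition n L" and a: "composition n a"
  shows "refines L (mset a) \<longleftrightarrow> a \<in> D_poset L"
proof
  assume "refines L (mset a)"
  then obtain p e I where pe: "mset p = L" "mset e = mset a"
    and I: "disjoint_family_on I {..<length e}" "(\<Union>k<length e. I k) = {..<length p}"
      "\<forall>k<length e. (\<Sum>j\<in>I k. p ! j) = e ! k"
    unfolding refines_def by blast
  have fin: "finite (I k)" if "k < length e" for k
    using I(2) that by (metis UN_upper finite_lessThan finite_subset lessThan_iff)
  define Ms where "Ms = map (\<lambda>k. image_mset ((!) p) (mset_set (I k))) [0..<length e]"
  have e: "e = map sum_mset Ms"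
    using I(3) by (intro nth_equalityI) (auto simp: Ms_def sum_unfold_sum_mset)
  have "sum_list (map (\<lambda>k. image_mset ((!) p) (mset_set (I k))) [0..<m]) =
      image_mset ((!) p) (mset_set (\<Union>k<m. I k))" if "m \<le> length e" for m
    using that
  proof (induction m)
    case (Suc m)
    have "I k \<inter> I m = {}" if "k < m" for k
      using disjoint_family_onD[OF I(1), of k m] Suc.prems that by simp
    then have "(\<Union>k<m. I k) \<inter> I m = {}" by blast
    then have "mset_set (\<Union>k<Suc m. I k) = mset_set (\<Union>k<m. I k) + mset_set (I m)"
      using fin Suc.prems mset_set_Union[of "\<Union>k<m. I k" "I m"]
      by (simp add: lessThan_Suc Un_commute)
    then show ?case using Suc by simp
  qed simp
  from this[of "length e"] have "sum_list Ms = image_mset ((!) p) (mset_set {..<length p})"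
    by (simp add: Ms_def I(2))
  also have "\<dots> = L" using pe(1) by (metis lessThan_atLeast0 map_nth mset_map mset_upt)
  finally have Ms: "sum_list Ms = L" .
  obtain Ns where Ns: "mset Ns = mset Ms" "a = map sum_mset Ns"
    using mset_eq_mset_map[of a sum_mset Ms] pe(2) e by metis
  have "sum_list Ns = L" using Ms Ns(1) by (metis sum_mset_sum_list)
  then show "a \<in> D_poset L" using a Ns D_poset_iff[OF L] by auto
next
  assume "a \<in> D_poset L"
  then obtain b where b: "mset b = L" "comp_le a b" by (auto simp: D_poset_def)
  then obtain i where i: "i 0 = 0" "i (length a) = length b"
      "\<And>j. j < length a \<Longrightarrow> i j < i (Suc j) \<and> a ! j = (\<Sum>k = i j..<i (Suc j). b ! k)"
    unfolding comp_le_def by auto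
  have mono: "i j \<le> i k" if "j \<le> k" "k \<le> length a" for j k
    using that
  proof (induction k)
    case (Suc k)
    then show ?case using i(3)[of k] by (cases "j = Suc k") auto
  qed simp
  have un: "(\<Union>k<m. {i k..<i (Suc k)}) = {..<i m}" if "m \<le> length a" for m
    using that
  proof (induction m)
    case (Suc m)
    then have "{..<i m} \<union> {i m..<i (Suc m)} = {..<i (Suc m)}"
      using i(3)[of m] by (intro ivl_disj_un_one) simp
    then show ?case using Suc by (simp add: lessThan_Suc Un_commute)
  qed (simp add: i(1))
  have "{i j..<i (Suc j)} \<inter> {i k..<i (Suc k)} = {}" if "j < length a" "k < length a" "j \<noteq> k" for j k
    using mono[of "Suc j" k] mono[of "Suc k" j] that by (cases "j < k") auto
  then have "disjoint_family_on (\<lambda>k. {i k..<i (Suc k)}) {..<length a}"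
    by (auto simp: disjoint_family_on_def)
  moreover have "(\<Union>k<length a. {i k..<i (Suc k)}) = {..<length b}"
    using un i(2) by simp
  moreover have "\<forall>k<length a. (\<Sum>j\<in>{i k..<i (Suc k)}. b ! j) = a ! k"
    using i(3) by simp
  ultimately show "refines L (mset a)"
    unfolding refines_def using b(1)
    by - (rule exI[of _ b], rule exI[of _ a], rule conjI, assumption, rule conjI, rule refl,
        rule exI[of _ "\<lambda>k. {i k..<i (Suc k)}"], intro conjI)
qed

lemma D_poset_composition: "number_partition n L \<Longrightarrow> a \<in> D_poset L \<Longrightarrow> composition n a"
  by (simp add: D_poset_iff)

text \<open>Deleting a cut merges two neighbouring blocks, and the groups of parts behind them are
  united.\<close>

lemma D_poset_remove:
  assumes L: "number_partition n L" and a: "a \<in> D_poset L" and y: "y \<in> cuts a"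
  obtains a' where "a' \<in> D_poset L" "cuts a' = cuts a - {y}"
proof -
  obtain k where k: "0 < k" "k < length a" "y = (\<Sum>j<k. a ! j)" using y by (auto simp: cuts_def)
  then obtain j where j: "k = Suc j" by (cases k) auto
  define u where "u = take j a"
  define v where "v = drop (Suc k) a"
  have eq: "a = u @ a ! j # a ! k # v"
    using k j unfolding u_def v_def by (metis Cons_nth_drop_Suc Suc_lessD append_take_drop_id)
  have yu: "y = sum_list u + a ! j" using k j by (simp add: u_def sum_list_take_nth)
  obtain Ms where comp: "composition n a" and Ms: "a = map sum_mset Ms" "sum_list Ms = L"
    using a D_poset_iff[OF L] by auto
  have "map sum_mset Ms = u @ a ! j # a ! k # v" using eq Ms(1) by metis
  then obtain Mu X Y Mv where M: "Ms = Mu @ X # Y # Mv" "u = map sum_mset Mu" "v = map sum_mset Mv"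
      "a ! j = sum_mset X" "a ! k = sum_mset Y"
    unfolding map_eq_append_conv map_eq_Cons_conv by blast
  have "u @ (a ! j + a ! k) # v \<in> D_poset L"
    unfolding D_poset_iff[OF L]
  proof (intro conjI exI[of _ "Mu @ (X + Y) # Mv"])
    show "composition n (u @ (a ! j + a ! k) # v)" using composition_split comp eq by metis
  qed (use M Ms in \<open>auto simp: add.assoc\<close>)
  moreover have "cuts (u @ (a ! j + a ! k) # v) = cuts a - {y}"
    using cuts_merge[of n u "a ! j" "a ! k" v] comp eq yu by metis
  ultimately show ?thesis using that by blast
qed

lemma delta_down_closed:
  assumes L: "number_partition n L" and F: "F \<in> delta L" and G: "G \<subseteq> F"
  shows "G \<in> delta L"
proof -
  \<comment> \<open>Cuts are removed one at a time, each removal being a single merge.\<close>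
  have "F - H \<in> delta L" if "finite H" for H
    using that
  proof (induction H)
    case (insert y H)
    then obtain a where a: "a \<in> D_poset L" "F - H = cuts a" by (auto simp: delta_def)
    show ?case
    proof (cases "y \<in> cuts a")
      case True
      then obtain a' where "a' \<in> D_poset L" "cuts a' = cuts a - {y}"
        using D_poset_remove[OF L a(1)] by blast
      then have "F - insert y H = cuts a'" using a(2) by auto
      then show ?thesis using \<open>a' \<in> D_poset L\<close> by (auto simp: delta_def)
    next
      case False
      then have "F - insert y H = F - H" using a(2) by auto
      then show ?thesis using insert.IH by simp
    qed
  qed (use F in simp)
  moreover have "finite (F - G)" using F by (auto simp: delta_def cuts_def)
  ultimately have "F - (F - G) \<in> delta L" by blast
  then show ?thesis using G by (simp add: double_diff)
qed

lemma delta_subset: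
  assumes "number_partition n L"
  shows "delta L \<subseteq> Pow {0<..<n}"
  using cuts_subset D_poset_composition[OF assms] by (force simp: delta_def)

section \<open>Collapsibility from a perfect acyclic matching\<close>

text \<open>Complexes contain the empty face, so a point is the pair \<open>{{}, {v}}\<close>. The
  condition \<open>\<sigma> \<noteq> {}\<close> keeps this pair from being collapsed away.
  Finiteness and closure under subsets sit in the rule so that they are at hand in inductions over a
  collapse.\<close>

inductive collapsible :: "'a set set \<Rightarrow> bool" where
  point: "collapsible {{}, {v}}"
| collapse: "finite K \<Longrightarrow> \<forall>F\<in>K. Pow F \<subseteq> K \<Longrightarrow>
    \<sigma> \<noteq> {} \<Longrightarrow> v \<notin> \<sigma> \<Longrightarrow> insert v \<sigma> \<in> K \<Longrightarrow>
    \<forall>F\<in>K. \<sigma> \<subseteq> F \<longrightarrow> F = \<sigma> \<or> F = insert v \<sigma> \<Longrightarrow>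
    collapsible (K - {\<sigma>, insert v \<sigma>}) \<Longrightarrow> collapsible K"

text \<open>A free face is found among the matched pairs of top dimension: take one maximizing the
  potential \<open>\<mu>\<close>.\<close>

lemma collapsible_if_perfect_matching:
  fixes \<mu> :: "'a set \<Rightarrow> nat"
  assumes "finite K" and "K \<noteq> {}" and "\<And>F. F \<in> K \<Longrightarrow> finite F"
    and "\<And>F G. F \<in> K \<Longrightarrow> G \<subseteq> F \<Longrightarrow> G \<in> K"
    and "\<And>\<sigma> \<tau>. (\<sigma>, \<tau>) \<in> M \<Longrightarrow> \<sigma> \<in> K \<and> \<tau> \<in> K \<and> (\<exists>v. v \<notin> \<sigma> \<and> \<tau> = insert v \<sigma>)"
    and "\<And>F. F \<in> K \<Longrightarrow> \<exists>G. (F, G) \<in> M \<or> (G, F) \<in> M"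
    and "\<And>\<sigma> \<tau> \<sigma>' \<tau>'. (\<sigma>, \<tau>) \<in> M \<Longrightarrow> (\<sigma>', \<tau>') \<in> M \<Longrightarrow> (\<sigma>, \<tau>) \<noteq> (\<sigma>', \<tau>') \<Longrightarrow>
      {\<sigma>, \<tau>} \<inter> {\<sigma>', \<tau>'} = {}"
    and "\<And>\<sigma> \<tau> \<sigma>' \<tau>' v. (\<sigma>, \<tau>) \<in> M \<Longrightarrow> (\<sigma>', \<tau>') \<in> M \<Longrightarrow> v \<notin> \<sigma>' \<Longrightarrow> \<tau> = insert v \<sigma>' \<Longrightarrow>
      \<sigma>' \<noteq> \<sigma> \<Longrightarrow> \<mu> \<sigma>' < \<mu> \<sigma>"
  shows "collapsible K"
  using assms
proof (induction "card K" arbitrary: K M rule: less_induct)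
  case less
  note fin = less.prems(1) and ne = less.prems(2) and finF = less.prems(3)
    and down = less.prems(4) and pair = less.prems(5) and perfect = less.prems(6)
    and disj = less.prems(7) and pot = less.prems(8)
  define d where "d = Max (card ` K)"
  have d: "card F \<le> d" if "F \<in> K" for F using that fin by (simp add: d_def)
  obtain F where F: "F \<in> K" "card F = d"
    using Max_in[of "card ` K"] fin ne unfolding d_def by fastforce
  define T where "T = {(\<sigma>, \<tau>) \<in> M. card \<tau> = d}"
  have "M \<subseteq> K \<times> K" using pair by auto
  then have "finite M" using fin finite_subset by blast
  then have finT: "finite T" unfolding T_def by (rule rev_finite_subset) auto
  have cardT: "card \<tau> = Suc (card \<sigma>)" if "(\<sigma>, \<tau>) \<in> M" for \<sigma> \<tau>
    using pair[OF that] finF by auto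
  \<comment> \<open>A face of maximal size cannot have a larger partner, so it is an upper
    element.\<close>
  have topF: "\<exists>G. (G, H) \<in> T" if "H \<in> K" "card H = d" for H
  proof -
    from perfect[OF that(1)] obtain G where "(H, G) \<in> M \<or> (G, H) \<in> M" by blast
    moreover have "(H, G) \<notin> M" using cardT[of H G] d[of G] pair[of H G] that by auto
    ultimately show ?thesis using that by (auto simp: T_def)
  qed
  then have "(\<mu> \<circ> fst) ` T \<noteq> {}" using F by auto
  then have "Max ((\<mu> \<circ> fst) ` T) \<in> (\<mu> \<circ> fst) ` T" using finT by (intro Max_in) auto
  then obtain \<sigma> \<tau> where st: "(\<sigma>, \<tau>) \<in> T" "\<mu> \<sigma> = Max ((\<mu> \<circ> fst) ` T)" by auto
  have max: "\<mu> \<sigma>' \<le> \<mu> \<sigma>" if "(\<sigma>', \<tau>') \<in> T" for \<sigma>' \<tau>'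
    using that finT unfolding st(2) by (intro Max_ge) (auto intro!: image_eqI[of _ _ "(\<sigma>', \<tau>')"])
  have stM: "(\<sigma>, \<tau>) \<in> M" and "card \<tau> = d" using st by (auto simp: T_def)
  obtain v where v: "v \<notin> \<sigma>" "\<tau> = insert v \<sigma>" "\<sigma> \<in> K" "\<tau> \<in> K" using pair[OF stM] by blast
  \<comment> \<open>A proper coface \<open>G\<close> has top size, hence is the upper element of
    some pair. If its partner \<open>\<sigma>'\<close> differed from \<open>\<sigma>\<close>,
    descending from \<open>G\<close> to \<open>\<sigma>\<close> would be a gradient step, and
    \<open>\<sigma>'\<close> would have larger potential than the maximal one.\<close>
  have free: "G = \<sigma> \<or> G = \<tau>" if G: "G \<in> K" "\<sigma> \<subseteq> G" for G
  proof (cases "G = \<sigma>")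
    case False
    then have "card \<sigma> < card G" using G finF psubset_card_mono by (metis psubsetI)
    then have cG: "card G = d" using d[OF G(1)] cardT[OF stM] \<open>card \<tau> = d\<close> by simp
    obtain \<sigma>' where s': "(\<sigma>', G) \<in> T" using topF[OF G(1) cG] by blast
    have "card (G - \<sigma>) = 1"
      using cG cardT[OF stM] \<open>card \<tau> = d\<close> G finF v by (simp add: card_Diff_subset)
    then obtain w where "G - \<sigma> = {w}" using card_1_singletonE by blast
    then have w: "w \<notin> \<sigma>" "G = insert w \<sigma>" using G by auto
    have "\<sigma>' = \<sigma>"
    proof (rule ccontr)
      assume "\<sigma>' \<noteq> \<sigma>"
      then have "\<mu> \<sigma> < \<mu> \<sigma>'" using pot[of \<sigma>' G \<sigma> \<tau> w] s' stM w by (auto simp: T_def)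
      then show False using max[OF s'] by simp
    qed
    then show ?thesis using disj[OF stM, of \<sigma>' G] s' by (auto simp: T_def)
  qed simp
  show ?case
  proof (cases "\<sigma> = {}")
    case True
    \<comment> \<open>Every face contains the empty one, so freeness leaves only the pair
      itself.\<close>
    then have "K = {{}, {v}}" using free v by auto
    then show ?thesis by (simp add: collapsible.point)
  next
    case False
    have "collapsible (K - {\<sigma>, \<tau>})"
    proof (rule less.hyps[of _ "M - {(\<sigma>, \<tau>)}"])
      show "card (K - {\<sigma>, \<tau>}) < card K" using v fin by (intro psubset_card_mono) auto
      show "K - {\<sigma>, \<tau>} \<noteq> {}" using down[OF v(3), of "{}"] False v by auto
      show "G \<in> K - {\<sigma>, \<tau>}" if "F \<in> K - {\<sigma>, \<tau>}" "G \<subseteq> F" for F G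
        using that down[of F G] free[of F] v by auto
      show "\<sigma>' \<in> K - {\<sigma>, \<tau>} \<and> \<tau>' \<in> K - {\<sigma>, \<tau>} \<and> (\<exists>v. v \<notin> \<sigma>' \<and> \<tau>' = insert v \<sigma>')"
        if "(\<sigma>', \<tau>') \<in> M - {(\<sigma>, \<tau>)}" for \<sigma>' \<tau>'
        using pair[of \<sigma>' \<tau>'] disj[OF stM, of \<sigma>' \<tau>'] that by auto
      show "\<exists>G. (F, G) \<in> M - {(\<sigma>, \<tau>)} \<or> (G, F) \<in> M - {(\<sigma>, \<tau>)}" if "F \<in> K - {\<sigma>, \<tau>}" for F
        using perfect[of F] that by auto
      show "{\<sigma>1, \<tau>1} \<inter> {\<sigma>', \<tau>'} = {}" if "(\<sigma>1, \<tau>1) \<in> M - {(\<sigma>, \<tau>)}"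
        "(\<sigma>', \<tau>') \<in> M - {(\<sigma>, \<tau>)}" "(\<sigma>1, \<tau>1) \<noteq> (\<sigma>', \<tau>')" for \<sigma>1 \<tau>1 \<sigma>' \<tau>'
        using that by (intro disj) auto
      show "\<mu> \<sigma>' < \<mu> \<sigma>1" if "(\<sigma>1, \<tau>1) \<in> M - {(\<sigma>, \<tau>)}"
        "(\<sigma>', \<tau>') \<in> M - {(\<sigma>, \<tau>)}" "v \<notin> \<sigma>'" "\<tau>1 = insert v \<sigma>'" "\<sigma>' \<noteq> \<sigma>1" for \<sigma>1 \<tau>1 \<sigma>' \<tau>' v
        using that by (intro pot[of \<sigma>1 \<tau>1 \<sigma>' \<tau>' v]) auto
    qed (use fin finF in auto)
    then show ?thesis
      using collapsible.collapse[of K \<sigma> v] fin down False v free by blast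
  qed
qed

section \<open>The matching on sets of cuts\<close>

lemma consec_next:
  assumes "y \<in> insert 0 C" "y < n" "finite C"
  obtains z where "consec n C y z"
proof -
  define Z where "Z = {t \<in> insert n C. y < t}"
  have Z: "finite Z" "Z \<noteq> {}" using assms by (auto simp: Z_def)
  have "Min Z \<in> Z" using Z by simp
  moreover have "Min Z \<le> t" if "t \<in> C" "y < t" for t using that Z by (simp add: Z_def)
  ultimately have "consec n C y (Min Z)"
    using assms unfolding consec_def Z_def mem_Collect_eq by (meson not_le)
  then show ?thesis using that by blast
qed

lemma consec_prev:
  assumes "y \<in> insert n C" "0 < y" "finite C"
  obtains x where "consec n C x y"
proof -
  define Z where "Z = {t \<in> insert 0 C. t < y}"
  have Z: "finite Z" "Z \<noteq> {}" using assms by (auto simp: Z_def)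
  have "Max Z \<in> Z" using Z by simp
  moreover have "t \<le> Max Z" if "t \<in> C" "t < y" for t using that Z by (simp add: Z_def)
  ultimately have "consec n C (Max Z) y"
    using assms unfolding consec_def Z_def mem_Collect_eq by (meson not_le)
  then show ?thesis using that by blast
qed

text \<open>What the matching uses about compositions, in terms of cuts: \<open>w\<close> stands for
  the distinguished part and \<open>B\<close> for the subset sums of the others. The Cutting
  Condition enters as \<open>gap_split\<close>, the exchange argument as
  \<open>gap_after\<close>.\<close>

locale marked_complex =
  fixes n w :: nat and B :: "nat set" and K :: "nat set set"
  assumes K_sub: "K \<subseteq> Pow {0<..<n}"
    and K_down: "F \<in> K \<Longrightarrow> G \<subseteq> F \<Longrightarrow> G \<in> K"
    and K_ne: "K \<noteq> {}"
    and w_pos: "0 < w"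
    and zero_B: "0 \<in> B"
    and gap_ex: "C \<in> K \<Longrightarrow> \<exists>x y. consec n C x y \<and> y - x \<in> (+) w ` B"
    and gap_cases: "C \<in> K \<Longrightarrow> consec n C x y \<Longrightarrow> y - x \<in> (+) w ` B \<or> y - x \<in> B"
    and gap_split: "C \<in> K \<Longrightarrow> consec n C x y \<Longrightarrow> y - x \<in> (+) w ` B \<Longrightarrow> y - x \<noteq> w \<Longrightarrow>
      insert (x + w) C \<in> K"
    and gap_after: "C \<in> K \<Longrightarrow> consec n C x y \<Longrightarrow> consec n C y z \<Longrightarrow> y - x = w \<Longrightarrow> z - y \<in> B"
begin

definition "mark C = (LEAST x. \<exists>y. consec n C x y \<and> y - x \<in> (+) w ` B)"

text \<open>The marked block has size at least \<open>w\<close>. So \<open>mark C + w\<close> is in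
  \<open>C\<close> if that block has size \<open>w\<close> and is not last, it is \<open>n\<close>
  if the block has size \<open>w\<close> and is last, and otherwise it is a new cut inside the
  block. The last alternative describes the lower elements, the middle one the critical
  cells.\<close>

definition "pairs = {(C, insert (mark C + w) C) | C. C \<in> K \<and> mark C + w \<notin> insert n C}"

lemma finite_face: "C \<in> K \<Longrightarrow> finite C"
  using K_sub by (intro finite_subset[of C "{0<..<n}"]) auto

lemma finite_K: "finite K"
  using K_sub by (rule finite_subset) simp

lemma mark_consec:
  assumes "C \<in> K"
  obtains y where "consec n C (mark C) y" "y - mark C \<in> (+) w ` B"
  using LeastI_ex[OF gap_ex[OF assms]] unfolding mark_def by blast

lemma mark_le: "consec n C x y \<Longrightarrow> y - x \<in> (+) w ` B \<Longrightarrow> mark C \<le> x"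
  unfolding mark_def by (rule Least_le) blast

lemma w_gap: "w \<in> (+) w ` B"
  using zero_B by (auto intro: image_eqI[of _ _ 0])

text \<open>Leastness is a condition on the blocks to the left only, so it is enough that no new
  block arises there.\<close>

lemma mark_eqI:
  assumes "consec n C (mark D) y" "y - mark D \<in> (+) w ` B"
    and same: "\<And>x z. x < mark D \<Longrightarrow> consec n C x z \<Longrightarrow> consec n D x z"
    and "C \<in> K"
  shows "mark C = mark D"
proof -
  obtain z where z: "consec n C (mark C) z" "z - mark C \<in> (+) w ` B"
    using mark_consec[OF \<open>C \<in> K\<close>] by blast
  have "\<not> mark C < mark D"
    using same[of "mark C" z] z mark_le[of D "mark C" z] by auto
  then show ?thesis using mark_le[OF assms(1,2)] by simp
qed

text \<open>After the split the block starting at the mark has size \<open>w\<close>, which still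
  qualifies because \<open>0 \<in> B\<close>.\<close>

lemma mark_insert:
  assumes C: "C \<in> K" and nin: "mark C + w \<notin> insert n C"
  shows "insert (mark C + w) C \<in> K" and "mark (insert (mark C + w) C) = mark C"
proof -
  obtain y where y: "consec n C (mark C) y" "y - mark C \<in> (+) w ` B"
    using mark_consec[OF C] by blast
  have "mark C < y" using y by (simp add: consec_def)
  have "y - mark C \<ge> w" using y by auto
  moreover have "y \<noteq> mark C + w" using y nin by (auto simp: consec_def)
  ultimately have lt: "mark C + w < y" using \<open>mark C < y\<close> by linarith
  show D: "insert (mark C + w) C \<in> K" using gap_split[OF C y] lt by simp
  show "mark (insert (mark C + w) C) = mark C"
  proof (rule mark_eqI[OF _ _ _ D])
    show "consec n (insert (mark C + w) C) (mark C) (mark C + w)"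
      using y(1) lt w_pos unfolding consec_def by auto
    show "mark C + w - mark C \<in> (+) w ` B" using w_gap by simp
    show "consec n C x z" if "x < mark C" "consec n (insert (mark C + w) C) x z" for x z
      using that y(1) w_pos unfolding consec_def by auto
  qed
qed

text \<open>A cut at \<open>mark C + w\<close> forces the marked block to have size exactly
  \<open>w\<close>. By \<open>gap_after\<close> its successor has size in \<open>B\<close>, so the
  merged block qualifies again.\<close>

lemma mark_remove:
  assumes C: "C \<in> K" and i: "mark C + w \<in> C"
  shows "C - {mark C + w} \<in> K" and "mark (C - {mark C + w}) = mark C"
proof -
  obtain y where y: "consec n C (mark C) y" "y - mark C \<in> (+) w ` B"
    using mark_consec[OF C] by blast
  have "mark C < y" using y by (simp add: consec_def)
  have "y - mark C \<ge> w" using y by auto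
  moreover have "\<not> mark C + w < y" using y(1) i w_pos by (auto simp: consec_def)
  ultimately have yw: "y = mark C + w" using \<open>mark C < y\<close> by linarith
  have yn: "y < n" using K_sub C i yw by fastforce
  obtain z where z: "consec n C y z"
    using consec_next[of y C n] i yw yn finite_face[OF C] by auto
  have zB: "z - y \<in> B" using gap_after[OF C y(1) z] yw by simp
  have yz: "y < z" using z by (simp add: consec_def)
  show D: "C - {mark C + w} \<in> K" using K_down[OF C] by auto
  show "mark (C - {mark C + w}) = mark C"
  proof (rule mark_eqI[OF _ _ _ D])
    show "consec n (C - {mark C + w}) (mark C) z"
      using y(1) z yw unfolding consec_def by force
    show "z - mark C \<in> (+) w ` B" using zB yw yz by (intro image_eqI[of _ _ "z - y"]) auto
    \<comment> \<open>Here \<open>mark C\<close> is itself a cut, since \<open>x\<close> lies to its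
      left; blocks starting before it end at or before it and do not see the deleted cut.\<close>
    show "consec n C x t" if "x < mark C" "consec n (C - {mark C + w}) x t" for x t
    proof -
      have "mark C \<in> C" using y(1) that(1) by (auto simp: consec_def)
      then have "\<not> mark C < t" using that w_pos by (auto simp: consec_def)
      then have "z \<noteq> mark C + w" if "z < t" for z using that w_pos by linarith
      then show ?thesis using that(2) unfolding consec_def by auto
    qed
  qed
qed

lemma pairs_upper:
  assumes "(C, D) \<in> pairs"
  shows "C \<in> K" "D \<in> K" "D = insert (mark C + w) C" "mark C + w \<notin> insert n C" "mark D = mark C"
  using assms mark_insert by (auto simp: pairs_def)

text \<open>Both members of a pair have the same mark, and only the upper one contains
  \<open>mark + w\<close>. So a set determines its role in a pair, and with it the partner.\<close>

lemma pairs_disjoint: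
  assumes "(C, D) \<in> pairs" "(C', D') \<in> pairs" "(C, D) \<noteq> (C', D')"
  shows "{C, D} \<inter> {C', D'} = {}"
proof -
  have "C \<noteq> D'" using pairs_upper[OF assms(1)] pairs_upper[OF assms(2)] by auto
  moreover have "C' \<noteq> D" using pairs_upper[OF assms(1)] pairs_upper[OF assms(2)] by auto
  moreover have "C = C'" if "D = D'"
  proof -
    have "mark C = mark C'" using that pairs_upper[OF assms(1)] pairs_upper[OF assms(2)] by simp
    then have "insert (mark C + w) C = insert (mark C + w) C'" "mark C + w \<notin> C" "mark C + w \<notin> C'"
      using that pairs_upper[OF assms(1)] pairs_upper[OF assms(2)] by auto
    then show ?thesis by (simp add: insert_ident)
  qed
  moreover have "C \<noteq> C'"
  proof
    assume "C = C'"
    then have "D = D'" using pairs_upper(3)[OF assms(1)] pairs_upper(3)[OF assms(2)] by simp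
    then show False using assms(3) \<open>C = C'\<close> by simp
  qed
  ultimately have "D \<noteq> D'" by blast
  with \<open>C \<noteq> D'\<close> \<open>C' \<noteq> D\<close> \<open>C \<noteq> C'\<close> show ?thesis by auto
qed

lemma unpaired_iff:
  assumes C: "C \<in> K"
  shows "(\<exists>D. (C, D) \<in> pairs \<or> (D, C) \<in> pairs) \<longleftrightarrow> mark C + w \<noteq> n"
proof
  assume "\<exists>D. (C, D) \<in> pairs \<or> (D, C) \<in> pairs"
  then obtain D where "(C, D) \<in> pairs \<or> (D, C) \<in> pairs" by blast
  then show "mark C + w \<noteq> n"
  proof
    assume "(C, D) \<in> pairs"
    from pairs_upper(4)[OF this] show ?thesis by simp
  next
    assume "(D, C) \<in> pairs"
    from pairs_upper(4,5)[OF this] show ?thesis by simp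
  qed
next
  assume n: "mark C + w \<noteq> n"
  show "\<exists>D. (C, D) \<in> pairs \<or> (D, C) \<in> pairs"
  proof (cases "mark C + w \<in> C")
    case True
    then have "(C - {mark C + w}, C) \<in> pairs"
      using mark_remove[OF C True] n by (auto simp: pairs_def)
    then show ?thesis by blast
  qed (use C n in \<open>auto simp: pairs_def\<close>)
qed

text \<open>Passing from \<open>D\<close> to the next lower element \<open>C'\<close> deletes a cut \<open>v\<close>. If \<open>v\<close> is not the left end \<open>x\<close>
  of the marked block, that block survives together with its right end \<open>x + w\<close>, so a mark at \<open>x\<close>
  would make \<open>C'\<close> an upper element. If \<open>v = x\<close>, the block before \<open>x\<close> has size in \<open>B\<close> and grows by \<open>w\<close>.\<close>

lemma mark_decreases:
  assumes p: "(C, D) \<in> pairs" and p': "(C', D') \<in> pairs"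
    and v: "v \<notin> C'" "D = insert v C'" and "C' \<noteq> C"
  shows "mark C' < mark C"
proof -
  note 1 = pairs_upper[OF p] and 2 = pairs_upper[OF p']
  define x where "x = mark C"
  have C': "C' = D - {v}" and vD: "v \<in> D" using v by auto
  have vx: "v \<noteq> x + w" using 1 C' \<open>C' \<noteq> C\<close> by (auto simp: x_def)
  have xwC': "x + w \<in> C'" using v 1 vx by (auto simp: x_def)
  obtain y where y: "consec n D x y" "y - x \<in> (+) w ` B" using mark_consec[OF 1(2)] 1(5) x_def by metis
  have "x < y" using y by (simp add: consec_def)
  moreover have "y - x \<ge> w" using y by auto
  moreover have "\<not> x + w < y" using y(1) xwC' v w_pos by (auto simp: consec_def)
  ultimately have yw: "y = x + w" by linarith
  show ?thesis
  proof (cases "v = x")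
    case False
    have "consec n C' x y" using y(1) False vx yw xwC' C' by (auto simp: consec_def)
    then have "mark C' \<le> x" using y(2) mark_le by blast
    moreover have "mark C' \<noteq> x" using 2(4) xwC' by auto
    ultimately show ?thesis by (simp add: x_def)
  next
    case True
    have x0: "0 < x" using vD True 1(2) K_sub by fastforce
    obtain t where t: "consec n D t x"
      using consec_prev[of x n D] vD True x0 finite_face[OF 1(2)] by auto
    have tx: "t < x" using t by (simp add: consec_def)
    have "x - t \<notin> (+) w ` B" using mark_le[OF t] tx 1(5) by (auto simp: x_def)
    then have "x - t \<in> B" using gap_cases[OF 1(2) t] by blast
    then have "y - t \<in> (+) w ` B" using yw tx by (intro image_eqI[of _ _ "x - t"]) auto
    moreover have "consec n C' t y"
      using t y(1) True C' yw by (force simp: consec_def)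
    ultimately have "mark C' \<le> t" using mark_le by blast
    then show ?thesis using tx by (simp add: x_def)
  qed
qed

lemma collapsible_if_no_critical:
  assumes "\<And>C. C \<in> K \<Longrightarrow> mark C + w \<noteq> n"
  shows "collapsible K"
proof (rule collapsible_if_perfect_matching[where M = pairs and \<mu> = mark])
  show "\<sigma> \<in> K \<and> \<tau> \<in> K \<and> (\<exists>v. v \<notin> \<sigma> \<and> \<tau> = insert v \<sigma>)" if "(\<sigma>, \<tau>) \<in> pairs" for \<sigma> \<tau>
    using pairs_upper[OF that] by blast
  show "\<exists>G. (F, G) \<in> pairs \<or> (G, F) \<in> pairs" if "F \<in> K" for F
    using unpaired_iff[OF that] assms[OF that] by blast
  show "mark \<sigma>' < mark \<sigma>"
    if "(\<sigma>, \<tau>) \<in> pairs" "(\<sigma>', \<tau>') \<in> pairs" "v \<notin> \<sigma>'" "\<tau> = insert v \<sigma>'" "\<sigma>' \<noteq> \<sigma>" for \<sigma> \<tau> \<sigma>' \<tau>' v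
    by (rule mark_decreases[OF that])
  show "{\<sigma>, \<tau>} \<inter> {\<sigma>', \<tau>'} = {}"
    if "(\<sigma>, \<tau>) \<in> pairs" "(\<sigma>', \<tau>') \<in> pairs" "(\<sigma>, \<tau>) \<noteq> (\<sigma>', \<tau>')" for \<sigma> \<tau> \<sigma>' \<tau>'
    by (rule pairs_disjoint[OF that])
  show "G \<in> K" if "F \<in> K" "G \<subseteq> F" for F G by (rule K_down[OF that])
qed (rule finite_K K_ne finite_face, assumption?)+

end

section \<open>Compositions under the Cutting Condition\<close>

lemma subseteq_add_mset_notin:
  assumes "x \<notin># S" "S \<subseteq># add_mset x T"
  shows "S \<subseteq># T"
  unfolding subseteq_mset_def
proof
  fix y
  show "count S y \<le> count T y"
    using mset_subset_eq_count[OF assms(2), of y] assms(1)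
    by (cases "x = y") (auto simp: not_in_iff)
qed

lemma submset_index_set:
  fixes q :: "nat list"
  assumes "S \<subseteq># mset q"
  shows "\<exists>I\<subseteq>{..<length q}. (\<Sum>i\<in>I. q ! i) = sum_mset S"
  using assms
proof (induction q arbitrary: S)
  case (Cons y q)
  have "\<exists>S'. S' \<subseteq># mset q \<and> (S = S' \<or> S = add_mset y S')"
  proof (cases "y \<in># S")
    case True
    then obtain S' where S': "S = add_mset y S'" by (metis multi_member_split)
    then have "S' \<subseteq># mset q" using Cons.prems by simp
    then show ?thesis using S' by blast
  next
    case False
    then have "S \<subseteq># mset q" using Cons.prems by (simp add: subseteq_add_mset_notin)
    then show ?thesis by blast
  qed
  then obtain S' where S': "S' \<subseteq># mset q" "S = S' \<or> S = add_mset y S'" by blast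
  obtain I where I: "I \<subseteq> {..<length q}" "(\<Sum>i\<in>I. q ! i) = sum_mset S'" using Cons.IH[OF S'(1)] by blast
  have "finite I" using I(1) finite_subset by blast
  have s: "(\<Sum>i\<in>Suc ` I. (y # q) ! i) = sum_mset S'" using I by (simp add: sum.reindex)
  show ?case
  proof (cases "S = S'")
    case True
    then show ?thesis using s I by (intro exI[of _ "Suc ` I"]) auto
  next
    case False
    then show ?thesis using s I S'(2) \<open>finite I\<close>
      by (intro exI[of _ "insert 0 (Suc ` I)"]) (auto simp: sum.insert_if)
  qed
qed simp

text \<open>The Cutting Condition speaks of index sets, while grouping parts into blocks yields
  submultisets.\<close>

lemma subset_sums_tl:
  fixes p :: "nat list"
  assumes "p \<noteq> []"
  shows "{(\<Sum>j\<in>I. p ! j) | I. I \<subseteq> {1..<length p}} = {sum_mset S | S. S \<subseteq># mset (tl p)}"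
proof (intro equalityI subsetI)
  fix s assume "s \<in> {(\<Sum>j\<in>I. p ! j) | I. I \<subseteq> {1..<length p}}"
  then obtain I where I: "I \<subseteq> {1..<length p}" "s = (\<Sum>j\<in>I. p ! j)" by blast
  have "tl p = map ((!) p) [1..<length p]" by (rule nth_equalityI) (auto simp: nth_tl)
  then have "mset (tl p) = image_mset ((!) p) (mset_set {1..<length p})" by (metis mset_map mset_upt)
  then have "image_mset ((!) p) (mset_set I) \<subseteq># mset (tl p)"
    using I(1) by (simp add: image_mset_subseteq_mono subset_imp_msubset_mset_set)
  then show "s \<in> {sum_mset S | S. S \<subseteq># mset (tl p)}"
    using I(2) by (auto simp: sum_unfold_sum_mset)
next
  fix s assume "s \<in> {sum_mset S | S. S \<subseteq># mset (tl p)}"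
  then obtain I where I: "I \<subseteq> {..<length (tl p)}" "(\<Sum>i\<in>I. tl p ! i) = s"
    using submset_index_set by blast
  have "(\<Sum>j\<in>Suc ` I. p ! j) = s"
    using I by (auto simp: sum.reindex nth_tl intro!: sum.cong)
  moreover have "Suc ` I \<subseteq> {1..<length p}" using I(1) by auto
  ultimately show "s \<in> {(\<Sum>j\<in>I. p ! j) | I. I \<subseteq> {1..<length p}}" by blast
qed

lemma nth_add_nth_subseteq_sum_list:
  fixes Ms :: "'a multiset list"
  assumes "i < length Ms" "k < length Ms" "i \<noteq> k"
  shows "Ms ! i + Ms ! k \<subseteq># sum_list Ms"
proof -
  have "sum_list Ms = Ms ! i + (\<Sum>j\<in>{0..<length Ms} - {i}. Ms ! j)"
    using assms by (simp add: sum_list_sum_nth sum.remove)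
  also have "\<dots> = Ms ! i + (Ms ! k + (\<Sum>j\<in>{0..<length Ms} - {i} - {k}. Ms ! j))"
    using assms by (subst sum.remove[of "{0..<length Ms} - {i}" k]) auto
  also have "\<dots> = Ms ! i + Ms ! k + (\<Sum>j\<in>{0..<length Ms} - {i} - {k}. Ms ! j)"
    by (simp add: add.assoc)
  finally show ?thesis by simp
qed

lemma nth_subseteq_sum_list:
  fixes Ms :: "'a multiset list"
  assumes "i < length Ms"
  shows "Ms ! i \<subseteq># sum_list Ms"
  using assms by (simp add: sum_list_sum_nth sum.remove[of _ i])

lemma in_sum_list_mset: "x \<in># sum_list Ms \<Longrightarrow> \<exists>k<length Ms. x \<in># Ms ! k"
  for Ms :: "'a multiset list"
  by (auto simp: in_set_conv_nth)

locale cutting =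
  fixes n :: nat and p :: "nat list"
  assumes part: "number_partition n (mset p)" and p_ne: "p \<noteq> []" and cut: "cutting_condition p"
begin

definition "B = {(\<Sum>j\<in>I. p ! j) | I. I \<subseteq> {1..<length p}}"

lemma B_mset: "B = {sum_mset S | S. S \<subseteq># mset (tl p)}"
  unfolding B_def by (rule subset_sums_tl[OF p_ne])

lemma mset_p: "mset p = add_mset (p ! 0) (mset (tl p))"
  using p_ne by (cases p) auto

lemma n_eq: "n = sum_list p" and p_pos: "x \<in> set p \<Longrightarrow> 0 < x"
  using part by (auto simp: number_partition_def sum_mset_sum_list)

lemma w_pos: "0 < p ! 0"
  using p_pos p_ne by simp

lemma n_pos: "0 < n"
  using w_pos n_eq p_ne by (cases p) auto

lemma sub_cases:
  assumes "T \<subseteq># mset p"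
  shows "T \<subseteq># mset (tl p) \<or> (\<exists>S. T = add_mset (p ! 0) S \<and> S \<subseteq># mset (tl p))"
proof (cases "p ! 0 \<in># T")
  case True
  then obtain S where "T = add_mset (p ! 0) S" by (metis multi_member_split)
  then show ?thesis using assms by (simp add: mset_p)
next
  case False
  then have "T \<subseteq># mset (tl p)"
    using assms unfolding mset_p by (rule subseteq_add_mset_notin)
  then show ?thesis by simp
qed

lemma composition_D: "a \<in> D_poset (mset p) \<Longrightarrow> composition n a"
  using D_poset_composition[OF part] .

lemma D_blocks:
  assumes "a \<in> D_poset (mset p)"
  obtains Ms where "length Ms = length a" "\<And>k. k < length a \<Longrightarrow> a ! k = sum_mset (Ms ! k)"
    "sum_list Ms = mset p"
  using assms that by (auto simp: D_poset_iff[OF part])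

lemma block_cases:
  assumes "a \<in> D_poset (mset p)" "k < length a"
  shows "a ! k \<in> (+) (p ! 0) ` B \<or> a ! k \<in> B"
proof -
  obtain Ms where Ms: "length Ms = length a" "\<And>k. k < length a \<Longrightarrow> a ! k = sum_mset (Ms ! k)"
    "sum_list Ms = mset p" using D_blocks[OF assms(1)] by blast
  have "Ms ! k \<subseteq># mset p" using nth_subseteq_sum_list Ms assms by metis
  then consider "Ms ! k \<subseteq># mset (tl p)" | S where "Ms ! k = add_mset (p ! 0) S" "S \<subseteq># mset (tl p)"
    using sub_cases by blast
  then show ?thesis by cases (use Ms(2)[OF assms(2)] in \<open>auto simp: B_mset\<close>)
qed

lemma block_ex:
  assumes "a \<in> D_poset (mset p)"
  shows "\<exists>k<length a. a ! k \<in> (+) (p ! 0) ` B"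
proof -
  obtain Ms where Ms: "length Ms = length a" "\<And>k. k < length a \<Longrightarrow> a ! k = sum_mset (Ms ! k)"
    "sum_list Ms = mset p" using D_blocks[OF assms(1)] by blast
  have "p ! 0 \<in># sum_list Ms" using Ms(3) p_ne by simp
  from in_sum_list_mset[OF this] obtain k where k: "k < length Ms" "p ! 0 \<in># Ms ! k" by auto
  then obtain S where S: "Ms ! k = add_mset (p ! 0) S" by (metis multi_member_split)
  have "Ms ! k \<subseteq># mset p" using nth_subseteq_sum_list Ms(3) k(1) by metis
  then have "S \<subseteq># mset (tl p)" using S by (simp add: mset_p)
  then show ?thesis using Ms k S by (intro exI[of _ k]) (auto simp: B_mset)
qed

text \<open>If the distinguished part lies in the block \<open>k\<close>, exchange it with the parts that make up
  the block \<open>i\<close>.\<close>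

lemma other_block:
  assumes "a \<in> D_poset (mset p)" "i < length a" "k < length a" "i \<noteq> k" "a ! i = p ! 0"
  shows "a ! k \<in> B"
proof -
  obtain Ms where Ms: "length Ms = length a" "\<And>k. k < length a \<Longrightarrow> a ! k = sum_mset (Ms ! k)"
    "sum_list Ms = mset p" using D_blocks[OF assms(1)] by blast
  have sub: "Ms ! i + Ms ! k \<subseteq># mset p" using nth_add_nth_subseteq_sum_list Ms assms by metis
  have "Ms ! k \<subseteq># mset p" using nth_subseteq_sum_list Ms assms by metis
  then consider "Ms ! k \<subseteq># mset (tl p)" | S where "Ms ! k = add_mset (p ! 0) S" using sub_cases by blast
  then show ?thesis
  proof cases
    case 1
    then show ?thesis using Ms assms by (auto simp: B_mset)
  next
    case 2
    then have "Ms ! i + S \<subseteq># mset (tl p)" using sub by (simp add: mset_p)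
    moreover have "a ! k = sum_mset (Ms ! i + S)" using 2 Ms assms by simp
    ultimately show ?thesis unfolding B_mset by blast
  qed
qed

text \<open>A block of size \<open>p ! 0\<close> cannot contain that value twice, so a second copy
  lies in another block. Any copy may play the distinguished part: what remains of that block is a
  submultiset of the other parts.\<close>

lemma last_block_repeated:
  assumes rep: "i \<in> {1..<length p}" "p ! i = p ! 0"
    and a: "a \<in> D_poset (mset p)" "k < length a" "a ! k = p ! 0"
  shows "\<exists>j<length a. j \<noteq> k \<and> a ! j \<in> (+) (p ! 0) ` B"
proof -
  obtain Ms where Ms: "length Ms = length a" "\<And>k. k < length a \<Longrightarrow> a ! k = sum_mset (Ms ! k)"
    "sum_list Ms = mset p" using D_blocks[OF a(1)] by blast
  have "p ! 0 \<in> set (tl p)"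
    using rep by (auto simp: in_set_conv_nth nth_tl intro!: exI[of _ "i - 1"])
  then obtain R where R: "mset (tl p) = add_mset (p ! 0) R" by (metis multi_member_split set_mset_mset)
  have split: "mset p = Ms ! k + (\<Sum>j\<in>{0..<length Ms} - {k}. Ms ! j)"
    using Ms a by (simp add: sum_list_sum_nth sum.remove flip: Ms(3))
  have "count (Ms ! k) (p ! 0) \<le> 1"
  proof (rule ccontr)
    assume "\<not> ?thesis"
    then have "replicate_mset 2 (p ! 0) \<subseteq># Ms ! k"
      by (simp flip: count_le_replicate_mset_subset_eq)
    then obtain S where "Ms ! k = replicate_mset 2 (p ! 0) + S"
      by (auto simp: mset_subset_eq_exists_conv)
    then show False using Ms(2)[OF a(2)] a(3) w_pos by simp
  qed
  moreover have "count (mset p) (p ! 0) \<ge> 2" by (simp add: mset_p R)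
  ultimately have "0 < count (\<Sum>j\<in>{0..<length Ms} - {k}. Ms ! j) (p ! 0)"
    using arg_cong[OF split, of "\<lambda>M. count M (p ! 0)"] by (simp only: count_union)
  then have "(\<Sum>j\<in>{0..<length Ms} - {k}. count (Ms ! j) (p ! 0)) \<noteq> 0"
    unfolding count_sum by linarith
  then obtain j where "j \<in> {0..<length Ms} - {k}" "count (Ms ! j) (p ! 0) \<noteq> 0"
    by (rule sum.not_neutral_contains_not_neutral)
  then have j: "j < length Ms" "j \<noteq> k" "p ! 0 \<in># Ms ! j" by auto
  then obtain S where S: "Ms ! j = add_mset (p ! 0) S" by (metis multi_member_split)
  have "Ms ! j \<subseteq># mset p" using nth_subseteq_sum_list Ms(3) j(1) by metis
  then have "S \<subseteq># mset (tl p)" using S by (simp add: mset_p)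
  then show ?thesis using Ms j S by (intro exI[of _ j]) (auto simp: B_mset)
qed

text \<open>The only place where the Cutting Condition is used. It yields a refinement of unordered
  partitions; \<open>refines_iff_D_poset\<close> allows the two new blocks to stay in place of the
  old one, with \<open>p ! 0\<close> first.\<close>

lemma D_split:
  assumes a: "a \<in> D_poset (mset p)" "k < length a" and ak: "a ! k \<in> (+) (p ! 0) ` B" "a ! k \<noteq> p ! 0"
  shows "\<exists>b\<in>D_poset (mset p). cuts b = insert (sum_list (take k a) + p ! 0) (cuts a)"
proof -
  obtain I where I: "I \<subseteq> {1..<length p}" "a ! k = p ! 0 + (\<Sum>j\<in>I. p ! j)"
    using ak(1) by (auto simp: B_def)
  \<comment> \<open>The Cutting Condition asks for a nonempty \<open>I\<close>; the empty one would
    give a block of size \<open>p ! 0\<close>.\<close>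
  have "I \<noteq> {}" using I(2) ak(2) by auto
  define b where "b = take k a @ [p ! 0, \<Sum>j\<in>I. p ! j] @ drop (Suc k) a"
  have comp: "composition n a" using composition_D a by simp
  have "number_partition n (mset a)"
    using comp by (simp add: number_partition_def composition_def sum_mset_sum_list)
  then have "refines (mset p) (mset b)"
    using cut a I \<open>I \<noteq> {}\<close> refines_iff_D_poset[OF part comp]
    unfolding cutting_condition_def b_def n_eq by blast
  have ea: "a = take k a @ (p ! 0 + (\<Sum>j\<in>I. p ! j)) # drop (Suc k) a"
    using a(2) I(2) by (metis id_take_nth_drop)
  have "0 < (\<Sum>j\<in>I. p ! j)" using ak(2) I(2) by simp
  moreover have "sum_list b = sum_list a"
    using arg_cong[OF ea, of sum_list] by (simp add: b_def)
  ultimately have "composition n b"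
    using comp w_pos by (auto simp: b_def composition_def dest: in_set_takeD in_set_dropD)
  then have "b \<in> D_poset (mset p)"
    using refines_iff_D_poset[OF part] \<open>refines (mset p) (mset b)\<close> by blast
  moreover have "cuts b = insert (sum_list (take k a) + p ! 0) (cuts a)"
    using cuts_split[of "take k a" "p ! 0" "\<Sum>j\<in>I. p ! j" "drop (Suc k) a"] ea by (simp add: b_def)
  ultimately show ?thesis by blast
qed

lemma p_in_D: "p \<in> D_poset (mset p)"
  unfolding D_poset_iff[OF part]
proof (intro conjI exI[of _ "map (\<lambda>x. {#x#}) p"])
  show "composition n p" using n_eq p_pos by (simp add: composition_def)
  show "p = map sum_mset (map (\<lambda>x. {#x#}) p)" by (simp add: o_def)
  show "sum_list (map (\<lambda>x. {#x#}) p) = mset p" by (induction p) auto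
qed

lemma consec_D_iff:
  "a \<in> D_poset (mset p) \<Longrightarrow> consec n (cuts a) x y \<longleftrightarrow>
    (\<exists>k<length a. x = sum_list (take k a) \<and> y = x + a ! k)"
  by (rule consec_cuts_iff[OF composition_D n_pos])

sublocale marked_complex n "p ! 0" B "delta (mset p)"
proof
  show "delta (mset p) \<subseteq> Pow {0<..<n}" by (rule delta_subset[OF part])
  show "G \<in> delta (mset p)" if "F \<in> delta (mset p)" "G \<subseteq> F" for F G
    by (rule delta_down_closed[OF part that])
  show "delta (mset p) \<noteq> {}" using p_in_D by (auto simp: delta_def)
  show "0 < p ! 0" by (rule w_pos)
  show "0 \<in> B" by (auto simp: B_def intro: exI[of _ "{}"])
  fix C assume "C \<in> delta (mset p)"
  then obtain a where a: "a \<in> D_poset (mset p)" "C = cuts a" by (auto simp: delta_def)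
  note c = consec_D_iff[OF a(1), folded a(2)]
  show "\<exists>x y. consec n C x y \<and> y - x \<in> (+) (p ! 0) ` B"
  proof -
    obtain k where "k < length a" "a ! k \<in> (+) (p ! 0) ` B" using block_ex[OF a(1)] by blast
    then show ?thesis
      by (intro exI[of _ "sum_list (take k a)"] exI[of _ "sum_list (take k a) + a ! k"]) (auto simp: c)
  qed
  show "y - x \<in> (+) (p ! 0) ` B \<or> y - x \<in> B" if "consec n C x y" for x y
    using that block_cases[OF a(1)] unfolding c by fastforce
  show "insert (x + p ! 0) C \<in> delta (mset p)"
    if con: "consec n C x y" and "y - x \<in> (+) (p ! 0) ` B" "y - x \<noteq> p ! 0" for x y
  proof -
    obtain k where k: "k < length a" "x = sum_list (take k a)" "y = x + a ! k"
      using c[THEN iffD1, OF con] by auto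
    then show ?thesis using D_split[OF a(1) k(1)] that a(2) by (auto simp: delta_def)
  qed
  show "z - y \<in> B" if con: "consec n C x y" and con': "consec n C y z" and "y - x = p ! 0" for x y z
  proof -
    obtain k where k: "k < length a" "x = sum_list (take k a)" "y = x + a ! k"
      using c[THEN iffD1, OF con] by auto
    obtain j where j: "j < length a" "y = sum_list (take j a)" "z = y + a ! j"
      using c[THEN iffD1, OF con'] by auto
    have "k \<noteq> j" using k j that(1) by (auto simp: consec_def)
    then show ?thesis using other_block[OF a(1) k(1) j(1)] k j that(3) by simp
  qed
qed

text \<open>The marked block has size at least \<open>p ! 0\<close>, so a mark at
  \<open>n - p ! 0\<close> forces it to be last and of exactly this size; being leftmost then says
  that no earlier block qualifies.\<close>

lemma critical_iff:
  assumes a: "a \<in> D_poset (mset p)"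
  shows "mark (cuts a) + p ! 0 = n \<longleftrightarrow>
    last a = p ! 0 \<and> (\<forall>i<length a - 1. a ! i \<notin> (+) (p ! 0) ` B)"
proof -
  have comp: "composition n a" by (rule composition_D[OF a])
  have a_ne: "a \<noteq> []" using comp n_pos by (auto simp: composition_def)
  have C: "cuts a \<in> delta (mset p)" using a by (auto simp: delta_def)
  note c = consec_D_iff[OF a]
  obtain y where y: "consec n (cuts a) (mark (cuts a)) y" "y - mark (cuts a) \<in> (+) (p ! 0) ` B"
    using mark_consec[OF C] by blast
  then obtain k where k: "k < length a" "mark (cuts a) = sum_list (take k a)"
      "y = mark (cuts a) + a ! k"
    unfolding c by blast
  have tk: "sum_list (take (Suc j) a) = sum_list (take j a) + a ! j" if "j < length a" for j
    using that by (simp add: take_Suc_conv_app_nth)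
  have akB: "a ! k \<in> (+) (p ! 0) ` B" using y k by simp
  have mono: "sum_list (take i a) < sum_list (take j a)" if "i < j" "j \<le> length a" for i j
    using composition_psum_less[OF comp that] that by (simp add: sum_list_take_nth)
  have tot: "sum_list (take (length a) a) = n" using comp by (simp add: composition_def)
  have least: "k \<le> i" if "i < length a" "a ! i \<in> (+) (p ! 0) ` B" for i
  proof (rule ccontr)
    assume "\<not> k \<le> i"
    then have "sum_list (take i a) < sum_list (take k a)" using mono k(1) by simp
    moreover have "mark (cuts a) \<le> sum_list (take i a)"
      using that by (intro mark_le[of _ _ "sum_list (take i a) + a ! i"]) (auto simp: c)
    ultimately show False using k(2) by simp
  qed
  show ?thesis
  proof
    assume m: "mark (cuts a) + p ! 0 = n"
    have "p ! 0 \<le> a ! k" using akB by auto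
    have "Suc k = length a"
    proof (rule ccontr)
      assume "Suc k \<noteq> length a"
      then have "sum_list (take (Suc k) a) < n" using mono[of "Suc k" "length a"] k(1) tot by simp
      then show False using tk[OF k(1)] k(2) m \<open>p ! 0 \<le> a ! k\<close> by simp
    qed
    then have "mark (cuts a) + a ! k = n" using tk[OF k(1)] k(2) tot by simp
    then have "a ! k = p ! 0" using m by simp
    moreover have "k = length a - 1" using \<open>Suc k = length a\<close> by simp
    ultimately show "last a = p ! 0 \<and> (\<forall>i<length a - 1. a ! i \<notin> (+) (p ! 0) ` B)"
      using least a_ne by (metis Suc_diff_1 last_conv_nth length_greater_0_conv less_SucI not_le)
  next
    assume l: "last a = p ! 0 \<and> (\<forall>i<length a - 1. a ! i \<notin> (+) (p ! 0) ` B)"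
    then have "k = length a - 1"
      using akB k(1) by (metis One_nat_def Suc_pred a_ne length_greater_0_conv less_Suc_eq)
    then have "a ! k = p ! 0" "Suc k = length a" using l a_ne by (auto simp: last_conv_nth)
    then show "mark (cuts a) + p ! 0 = n" using tk[OF k(1)] k(2) tot by simp
  qed
qed

lemma collapsible_delta:
  assumes "i \<in> {1..<length p}" "p ! i = p ! 0"
  shows "collapsible (delta (mset p))"
proof (rule collapsible_if_no_critical)
  fix C assume "C \<in> delta (mset p)"
  then obtain a where a: "a \<in> D_poset (mset p)" "C = cuts a" by (auto simp: delta_def)
  have "a \<noteq> []" using composition_D[OF a(1)] n_pos by (auto simp: composition_def)
  show "mark C + p ! 0 \<noteq> n"
  proof
    assume "mark C + p ! 0 = n"
    then have l: "last a = p ! 0" "\<And>i. i < length a - 1 \<Longrightarrow> a ! i \<notin> (+) (p ! 0) ` B"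
      using critical_iff[OF a(1)] a(2) by auto
    obtain j where "j < length a" "j \<noteq> length a - 1" "a ! j \<in> (+) (p ! 0) ` B"
      using last_block_repeated[OF assms a(1), of "length a - 1"] l(1) \<open>a \<noteq> []\<close>
      by (auto simp: last_conv_nth)
    then show False using l(2)[of j] by simp
  qed
qed

text \<open>If two or more cuts were added, removing just one of them by
  \<open>D_poset_remove\<close> would give an element strictly in between.\<close>

lemma covers_insert:
  assumes "covers (D_poset (mset p)) comp_le b a"
  shows "\<exists>v. v \<notin> cuts a \<and> cuts b = insert v (cuts a)"
proof -
  have ab: "a \<in> D_poset (mset p)" "b \<in> D_poset (mset p)" "comp_le a b" "a \<noteq> b"
    using assms by (auto simp: covers_def)
  note le = comp_le_iff_cuts[OF composition_D composition_D]
  have sub: "cuts a \<subseteq> cuts b" "cuts a \<noteq> cuts b"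
    using ab le cuts_inject[OF composition_D composition_D] by blast+
  then obtain v where v: "v \<in> cuts b" "v \<notin> cuts a" by blast
  obtain c where c: "c \<in> D_poset (mset p)" "cuts c = cuts b - {v}"
    using D_poset_remove[OF part ab(2) v(1)] by blast
  have "comp_le a c" "comp_le c b" using le ab c sub v by auto
  then have "c = a \<or> c = b" using assms c(1) by (auto simp: covers_def)
  then show ?thesis using c(2) v by auto
qed

theorem acyclic_matching_D_poset:
  defines "M \<equiv> {(a, b). a \<in> D_poset (mset p) \<and> b \<in> D_poset (mset p) \<and> (cuts a, cuts b) \<in> pairs}"
  shows "acyclic_matching (D_poset (mset p)) comp_le M"
    and "critical_cells (D_poset (mset p)) M = {a \<in> D_poset (mset p). last a = p ! 0 \<and>
      (\<forall>i<length a - 1. a ! i \<notin> (+) (p ! 0) ` B)}"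
proof -
  note le = comp_le_iff_cuts[OF composition_D composition_D]
  note inject = cuts_inject[OF composition_D composition_D]
  have M: "a \<in> D_poset (mset p)" "b \<in> D_poset (mset p)" "(cuts a, cuts b) \<in> pairs"
    if "(a, b) \<in> M" for a b using that by (auto simp: M_def)
  have cov: "covers (D_poset (mset p)) comp_le b a" if "(a, b) \<in> M" for a b
  proof -
    note 1 = M[OF that]
    note 2 = pairs_upper[OF 1(3)]
    have "cuts a \<noteq> cuts b" using 2 by auto
    moreover have "c = a \<or> c = b" if "c \<in> D_poset (mset p)" "comp_le a c" "comp_le c b" for c
    proof -
      have "cuts a \<subseteq> cuts c" "cuts c \<subseteq> insert (mark (cuts a) + p ! 0) (cuts a)"
        using le that 1 2 by auto
      then have "cuts c = cuts a \<or> cuts c = cuts b" using 2(3) by auto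
      then show ?thesis using inject that 1 by blast
    qed
    ultimately show ?thesis using 1 2 le unfolding covers_def by auto
  qed
  have matching: "poset_matching (D_poset (mset p)) comp_le M"
    unfolding poset_matching_def
  proof (intro conjI ballI)
    show "case x of (\<sigma>, \<tau>) \<Rightarrow> covers (D_poset (mset p)) comp_le \<tau> \<sigma>" if "x \<in> M" for x
      using cov that by auto
    have "{a, b} \<inter> {a', b'} = {}" if "(a, b) \<in> M" "(a', b') \<in> M" "(a, b) \<noteq> (a', b')" for a b a' b'
    proof -
      note 1 = M[OF that(1)] and 2 = M[OF that(2)]
      have "(cuts a, cuts b) \<noteq> (cuts a', cuts b')" using inject 1 2 that(3) by blast
      then have "{cuts a, cuts b} \<inter> {cuts a', cuts b'} = {}" using pairs_disjoint[OF 1(3) 2(3)] by simp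
      then show ?thesis by auto
    qed
    then show "case x of (\<sigma>, \<tau>) \<Rightarrow> \<forall>(\<sigma>', \<tau>')\<in>M. (\<sigma>, \<tau>) \<noteq> (\<sigma>', \<tau>') \<longrightarrow> {\<sigma>, \<tau>} \<inter> {\<sigma>', \<tau>'} = {}"
      if "x \<in> M" for x using that by blast
  qed
  have dec: "mark (cuts a') < mark (cuts a)"
    if ab: "(a, b) \<in> M" "(a', b') \<in> M" and cv: "covers (D_poset (mset p)) comp_le b a'" and ne: "a \<noteq> a'" for a b a' b'
  proof -
    note 1 = M[OF ab(1)] and 2 = M[OF ab(2)]
    obtain v where "v \<notin> cuts a'" "cuts b = insert v (cuts a')" using covers_insert[OF cv] by blast
    moreover have "cuts a' \<noteq> cuts a" using inject 1 2 ne by blast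
    ultimately show ?thesis using mark_decreases[OF 1(3) 2(3)] by blast
  qed
  show "acyclic_matching (D_poset (mset p)) comp_le M"
    unfolding acyclic_matching_def
  proof (intro conjI notI matching)
    assume "\<exists>s \<sigma> \<tau>. 1 \<le> s \<and> (\<forall>i\<le>s. (\<sigma> i, \<tau> i) \<in> M) \<and> \<sigma> 0 \<noteq> \<sigma> (1::nat) \<and> \<sigma> 0 = \<sigma> s \<and>
         (\<forall>i<s. covers (D_poset (mset p)) comp_le (\<tau> i) (\<sigma> (Suc i)))"
    then obtain s :: nat and \<sigma> \<tau> where s: "1 \<le> s" "\<And>i. i \<le> s \<Longrightarrow> (\<sigma> i, \<tau> i) \<in> M" "\<sigma> 0 \<noteq> \<sigma> 1" "\<sigma> 0 = \<sigma> s"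
      "\<And>i. i < s \<Longrightarrow> covers (D_poset (mset p)) comp_le (\<tau> i) (\<sigma> (Suc i))" by blast
    \<comment> \<open>Only the first step of a cycle is required to change the element; later ones
      may stay, so the mark decreases weakly there and strictly at the start.\<close>
    have mono: "mark (cuts (\<sigma> (Suc i))) \<le> mark (cuts (\<sigma> i))" if "i < s" for i
    proof (cases "\<sigma> i = \<sigma> (Suc i)")
      case False
      then show ?thesis using dec[OF s(2) s(2) s(5), of i] that by simp
    qed simp
    have "mark (cuts (\<sigma> i)) \<le> mark (cuts (\<sigma> 1))" if "1 \<le> i" "i \<le> s" for i
      using that
    proof (induction i rule: dec_induct)
      case (step i)
      then show ?case using mono[of i] by simp
    qed simp
    then have "mark (cuts (\<sigma> s)) \<le> mark (cuts (\<sigma> 1))" using s(1) by simp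
    moreover have "mark (cuts (\<sigma> 1)) < mark (cuts (\<sigma> 0))"
      using dec[OF s(2) s(2), of 0 1] s(1,3) s(5)[of 0] by simp
    ultimately show False using s(4) by simp
  qed
  have "(\<exists>b. (a, b) \<in> M \<or> (b, a) \<in> M) \<longleftrightarrow> mark (cuts a) + p ! 0 \<noteq> n" if "a \<in> D_poset (mset p)" for a
  proof -
    have C: "cuts a \<in> delta (mset p)" using that by (auto simp: delta_def)
    have "(\<exists>b. (a, b) \<in> M \<or> (b, a) \<in> M) \<longleftrightarrow> (\<exists>D. (cuts a, D) \<in> pairs \<or> (D, cuts a) \<in> pairs)"
    proof
      assume "\<exists>D. (cuts a, D) \<in> pairs \<or> (D, cuts a) \<in> pairs"
      then obtain D where D: "(cuts a, D) \<in> pairs \<or> (D, cuts a) \<in> pairs" by blast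
      then have "D \<in> delta (mset p)" using pairs_upper(1)[of D "cuts a"] pairs_upper(2)[of "cuts a" D] by blast
      then obtain b where "b \<in> D_poset (mset p)" "D = cuts b" by (auto simp: delta_def)
      then show "\<exists>b. (a, b) \<in> M \<or> (b, a) \<in> M" using D that by (auto simp: M_def)
    qed (auto simp: M_def)
    then show ?thesis using unpaired_iff[OF C] by simp
  qed
  then show "critical_cells (D_poset (mset p)) M = {a \<in> D_poset (mset p). last a = p ! 0 \<and>
      (\<forall>i<length a - 1. a ! i \<notin> (+) (p ! 0) ` B)}"
    unfolding critical_cells_def using critical_iff by blast
qed

end

section \<open>Proper homotopies and one-point compactifications\<close>

text \<open>Neighbourhoods of infinity are complements of closed compact sets. By
  \<open>comp\<close> the preimage of such a set is compact, and in the Hausdorff space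
  \<open>Z\<close> it is therefore closed in all of \<open>Z\<close>, not merely in
  \<open>W\<close>.\<close>

lemma continuous_map_Alexandroff_extend:
  assumes Z: "Hausdorff_space Z" and W: "openin Z W"
    and f: "continuous_map (subtopology Z W) X f"
    and comp: "\<And>C. closedin X C \<Longrightarrow> compactin X C \<Longrightarrow> compactin Z {z \<in> W. f z \<in> C}"
  shows "continuous_map Z (Alexandroff_compactification X) (\<lambda>z. if z \<in> W then Some (f z) else None)"
    (is "continuous_map Z ?Y ?g")
proof -
  have WZ: "W \<subseteq> topspace Z" using W by (rule openin_subset)
  then have tW: "topspace (subtopology Z W) = W" by auto
  have fX: "f z \<in> topspace X" if "z \<in> W" for z
    using f that unfolding continuous_map_def tW by blast
  show ?thesis unfolding continuous_map_def
  proof (intro conjI allI impI)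
    show "?g \<in> topspace Z \<rightarrow> topspace ?Y" using fX by auto
    fix V assume "openin ?Y V"
    then consider U where "openin X U" "V = Some ` U"
      | C where "compactin X C" "closedin X C" "V = insert None (Some ` (topspace X - C))"
      unfolding openin_Alexandroff_compactification by blast
    then show "openin Z {z \<in> topspace Z. ?g z \<in> V}"
    proof cases
      case 1
      have "{z \<in> topspace Z. ?g z \<in> V} = {z \<in> topspace (subtopology Z W). f z \<in> U}"
        using 1 WZ unfolding tW by auto
      then have "openin (subtopology Z W) {z \<in> topspace Z. ?g z \<in> V}"
        using f 1(1) unfolding continuous_map_def by auto
      then show ?thesis using W openin_trans_full by blast
    next
      case 2
      have "{z \<in> topspace Z. ?g z \<in> V} = topspace Z - {z \<in> W. f z \<in> C}"
        using 2 fX by (auto simp: image_iff split: if_splits)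
      moreover have "closedin Z {z \<in> W. f z \<in> C}"
        using Z comp[OF 2(2,1)] by (rule compactin_imp_closedin)
      ultimately show ?thesis by auto
    qed
  qed
qed

lemma continuous_map_the_Alexandroff:
  "continuous_map (subtopology (Alexandroff_compactification X) (Some ` topspace X)) X the"
    (is "continuous_map ?S X the")
proof -
  have tS: "topspace ?S = Some ` topspace X" by auto
  have "openin ?S {u \<in> topspace ?S. the u \<in> U}" if U: "openin X U" for U
  proof -
    have "{u \<in> topspace ?S. the u \<in> U} = Some ` topspace X \<inter> Some ` U"
      unfolding tS using openin_subset[OF U] by auto
    then show ?thesis
      using U openin_subtopology_Int2[of "Alexandroff_compactification X" "Some ` U"] by simp
  qed
  then show ?thesis unfolding continuous_map_def by auto
qed

text \<open>A quantitative form of local compactness: leaving every compact set means that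
  \<open>N\<close> tends to infinity, so properness of a map reduces to an inequality between such
  functions.\<close>

definition exhausts :: "'a::metric_space set \<Rightarrow> ('a \<Rightarrow> real) \<Rightarrow> bool" where
  "exhausts X N \<longleftrightarrow> continuous_on X N \<and> (\<forall>B. compact {x \<in> X. N x \<le> B})"

lemma exhausts_locally_compact:
  assumes "exhausts X N"
  shows "locally_compact_space (top_of_set X)"
  unfolding locally_compact_space_def
proof
  fix x assume "x \<in> topspace (top_of_set X)"
  then have x: "x \<in> X" by simp
  have "openin (top_of_set X) (X \<inter> N -` {..<N x + 1})"
    using assms by (intro continuous_openin_preimage_gen) (auto simp: exhausts_def)
  moreover have "compactin (top_of_set X) {y \<in> X. N y \<le> N x + 1}"
    using assms by (auto simp: exhausts_def compactin_subtopology)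
  ultimately show "\<exists>U K. openin (top_of_set X) U \<and> compactin (top_of_set X) K \<and> x \<in> U \<and> U \<subseteq> K"
    using x by (intro exI[of _ "X \<inter> N -` {..<N x + 1}"] exI[of _ "{y \<in> X. N y \<le> N x + 1}"] conjI) auto
qed

lemma exhausts_Hausdorff:
  assumes "exhausts X N"
  shows "Hausdorff_space (Alexandroff_compactification (top_of_set X))"
  using exhausts_locally_compact[OF assms]
  by (simp add: Hausdorff_space_Alexandroff_compactification Hausdorff_space_subtopology)

text \<open>At times outside \<open>U\<close> the whole space is at infinity, which permits
  homotopies that push everything there. The condition \<open>bound\<close> is properness: where
  \<open>M\<close> stays bounded, neither can \<open>x\<close> escape nor can the time approach the
  complement of \<open>U\<close>.\<close>

lemma continuous_map_homotopy_Alexandroff: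
  fixes X :: "'a::metric_space set" and Y :: "'b::metric_space set" and h :: "real \<times> 'a \<Rightarrow> 'b"
  assumes X: "exhausts X N" and U: "openin (top_of_set {0..1}) U"
    and h: "continuous_on (U \<times> X) h" "h ` (U \<times> X) \<subseteq> Y"
    and M: "continuous_on Y (M :: 'b \<Rightarrow> real)"
    and bound: "\<And>B. \<exists>T B'. compact T \<and> T \<subseteq> U \<and> (\<forall>t\<in>U. \<forall>x\<in>X. M (h (t, x)) \<le> B \<longrightarrow> t \<in> T \<and> N x \<le> B')"
  shows "continuous_map
     (prod_topology (top_of_set {0..1}) (Alexandroff_compactification (top_of_set X)))
     (Alexandroff_compactification (top_of_set Y))
     (\<lambda>z. if z \<in> U \<times> Some ` X then Some (h (fst z, the (snd z))) else None)"
proof (rule continuous_map_Alexandroff_extend)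
  let ?A = "Alexandroff_compactification (top_of_set X)"
  let ?Z = "prod_topology (top_of_set {0..1::real}) ?A"
  let ?f = "\<lambda>z. h (fst z, the (snd z))"
  have U01: "U \<subseteq> {0..1}" by (rule openin_imp_subset[OF U])
  show "Hausdorff_space ?Z"
    using exhausts_Hausdorff[OF X] by (simp add: Hausdorff_space_prod_topology Hausdorff_space_subtopology)
  have "openin ?A (Some ` X)" by simp
  then show "openin ?Z (U \<times> Some ` X)" using U by (simp add: openin_prod_Times_iff)
  let ?P = "prod_topology (top_of_set U) (subtopology ?A (Some ` X))"
  have S: "subtopology ?Z (U \<times> Some ` X) = ?P"
    using U01 by (simp add: subtopology_Times subtopology_subtopology inf.absorb2)
  have "continuous_map ?P (top_of_set X) (the \<circ> snd)"
    using continuous_map_compose[OF continuous_map_snd, of "subtopology ?A (Some ` X)" "top_of_set X" the]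
      continuous_map_the_Alexandroff[of "top_of_set X"] by simp
  then have "continuous_map ?P (prod_topology (top_of_set U) (top_of_set X)) (\<lambda>z. (fst z, the (snd z)))"
    by (intro continuous_map_pairedI continuous_map_fst) (simp add: o_def)
  moreover have "continuous_map (prod_topology (top_of_set U) (top_of_set X)) (top_of_set Y) h"
    using h by (simp add: prod_topology_subtopology_eu image_subset_iff_funcset)
  ultimately have "continuous_map ?P (top_of_set Y) (h \<circ> (\<lambda>z. (fst z, the (snd z))))"
    by (rule continuous_map_compose)
  then show "continuous_map (subtopology ?Z (U \<times> Some ` X)) (top_of_set Y) ?f"
    unfolding S by (simp add: o_def)
  fix C assume C: "closedin (top_of_set Y) C" "compactin (top_of_set Y) C"
  have cC: "compact C" "C \<subseteq> Y" using C by (auto simp: compactin_subtopology)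
  then have "compact (M ` C)" using M by (meson compact_continuous_image continuous_on_subset)
  then have "bdd_above (M ` C)" by (intro bounded_imp_bdd_above compact_imp_bounded)
  then obtain B where B: "\<forall>y\<in>C. M y \<le> B" by (auto simp: bdd_above_def)
  from bound[of B] obtain T B' where T: "compact T" "T \<subseteq> U" "\<forall>t\<in>U. \<forall>x\<in>X. M (h (t, x)) \<le> B \<longrightarrow> t \<in> T \<and> N x \<le> B'"
    by (elim exE conjE)
  \<comment> \<open>The preimage of \<open>C\<close> is closed in this compact box, hence
    compact.\<close>
  define Q where "Q = T \<times> {x \<in> X. N x \<le> B'}"
  have Q: "compact Q" "Q \<subseteq> U \<times> X"
    using T X by (auto simp: Q_def exhausts_def intro: compact_Times)
  have "closed (Q \<inter> h -` C)"
    by (intro continuous_closed_preimage continuous_on_subset[OF h(1) Q(2)] compact_imp_closed Q(1) cC(1))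
  then have "compact (Q \<inter> (Q \<inter> h -` C))" using Q(1) by (intro compact_Int_closed)
  then have "compactin (prod_topology (top_of_set {0..1}) (top_of_set X)) (Q \<inter> h -` C)"
    using Q(2) U01 by (auto simp: prod_topology_subtopology_eu compactin_subtopology)
  moreover have "continuous_map (prod_topology (top_of_set {0..1::real}) (top_of_set X)) ?Z (\<lambda>z. (fst z, Some (snd z)))"
    by (intro continuous_map_pairedI continuous_map_fst
        continuous_map_compose[OF continuous_map_snd continuous_map_Some, unfolded o_def])
  ultimately have "compactin ?Z ((\<lambda>z. (fst z, Some (snd z))) ` (Q \<inter> h -` C))"
    by (rule image_compactin)
  moreover have "{z \<in> U \<times> Some ` X. ?f z \<in> C} = (\<lambda>z. (fst z, Some (snd z))) ` (Q \<inter> h -` C)"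
  proof (intro equalityI subsetI)
    fix z assume "z \<in> {z \<in> U \<times> Some ` X. ?f z \<in> C}"
    then obtain t x where tx: "z = (t, Some x)" "t \<in> U" "x \<in> X" "h (t, x) \<in> C" by auto
    then have "M (h (t, x)) \<le> B" using B by blast
    then have "(t, x) \<in> Q" using T(3) tx by (simp add: Q_def)
    then show "z \<in> (\<lambda>z. (fst z, Some (snd z))) ` (Q \<inter> h -` C)"
      using tx by (intro image_eqI[of _ _ "(t, x)"]) auto
  qed (use Q(2) in auto)
  ultimately show "compactin ?Z {z \<in> U \<times> Some ` X. ?f z \<in> C}" by simp
qed

text \<open>The case of a homotopy that is constant in time, restricted to time 0.\<close>

corollary continuous_map_Alexandroff_map_option:
  fixes X :: "'a::metric_space set" and Y :: "'b::metric_space set"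
  assumes X: "exhausts X N" and f: "continuous_on X f" "f ` X \<subseteq> Y"
    and M: "continuous_on Y M" "\<And>x. x \<in> X \<Longrightarrow> N x \<le> M (f x)"
  shows "continuous_map (Alexandroff_compactification (top_of_set X))
    (Alexandroff_compactification (top_of_set Y)) (map_option f)"
proof -
  let ?A = "Alexandroff_compactification (top_of_set X)"
  have "continuous_map (prod_topology (top_of_set {0..1::real}) ?A) (Alexandroff_compactification (top_of_set Y))
     (\<lambda>z. if z \<in> {0..1} \<times> Some ` X then Some ((f \<circ> snd) (fst z, the (snd z))) else None)" (is "continuous_map _ _ ?g")
  proof (rule continuous_map_homotopy_Alexandroff[where h = "f \<circ> snd" and U = "{0..1}", OF X _ _ _ M(1)])
    show "continuous_on ({0..1} \<times> X) (f \<circ> snd)"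
      using f(1) by (intro continuous_on_compose continuous_intros) auto
    show "\<exists>T B'. compact T \<and> T \<subseteq> {0..1::real} \<and>
        (\<forall>t\<in>{0..1}. \<forall>x\<in>X. M ((f \<circ> snd) (t, x)) \<le> B \<longrightarrow> t \<in> T \<and> N x \<le> B')" for B :: real
      by (rule exI[of _ "{0..1::real}"], rule exI[of _ B]) (auto intro: order_trans[OF M(2)])
  qed (use f(2) in auto)
  moreover have "continuous_map ?A (prod_topology (top_of_set {0..1}) ?A) (\<lambda>u. (0::real, u))"
    by (intro continuous_map_pairedI) auto
  ultimately have "continuous_map ?A (Alexandroff_compactification (top_of_set Y)) (?g \<circ> (\<lambda>u. (0, u)))"
    by (rule continuous_map_compose[rotated])
  then show ?thesis by (rule continuous_map_eq) auto
qed

text \<open>Homotopy domination suffices: moving by \<open>h\<close> at time 1 and then including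
  \<open>Y\<close> is homotopic to the identity of \<open>X\<close>. Since \<open>N\<close> is
  constant along \<open>h\<close>, all maps involved extend to infinity.\<close>

lemma contractible_Alexandroff_by_retraction:
  fixes X Y :: "'a::metric_space set" and h :: "real \<times> 'a \<Rightarrow> 'a"
  assumes X: "exhausts X N" and Y: "exhausts Y N" "Y \<subseteq> X"
    and h: "continuous_on ({0..1} \<times> X) h" "h ` ({0..1} \<times> X) \<subseteq> X"
    and h0: "\<And>x. x \<in> X \<Longrightarrow> h (0, x) = x" and h1: "\<And>x. x \<in> X \<Longrightarrow> h (1, x) \<in> Y"
    and N: "\<And>t x. t \<in> {0..1} \<Longrightarrow> x \<in> X \<Longrightarrow> N (h (t, x)) = N x"
    and contr: "contractible_space (Alexandroff_compactification (top_of_set Y))"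
  shows "contractible_space (Alexandroff_compactification (top_of_set X))"
proof (rule homotopy_dominated_contractibility[OF _ _ _ contr])
  let ?A = "Alexandroff_compactification (top_of_set X)"
  let ?r = "\<lambda>x. h (1, x)"
  have cN: "continuous_on X N" "continuous_on Y N" using X Y by (auto simp: exhausts_def)
  have r: "continuous_on X ?r"
    by (rule continuous_on_compose2[OF h(1), of X "\<lambda>x. (1, x)"]) (auto intro!: continuous_intros)
  show "continuous_map (Alexandroff_compactification (top_of_set Y)) ?A (map_option id)"
    using Y by (intro continuous_map_Alexandroff_map_option[OF Y(1) _ _ cN(1)]) auto
  show "continuous_map ?A (Alexandroff_compactification (top_of_set Y)) (map_option ?r)"
    using h1 N by (intro continuous_map_Alexandroff_map_option[OF X r _ cN(2)]) auto
  let ?H = "\<lambda>z. if z \<in> {0..1} \<times> Some ` X then Some (h (fst z, the (snd z))) else None"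
  have H: "continuous_map (prod_topology (top_of_set {0..1}) ?A) ?A ?H"
  proof (rule continuous_map_homotopy_Alexandroff[where h = h and U = "{0..1}", OF X _ h cN(1)])
    show "\<exists>T B'. compact T \<and> T \<subseteq> {0..1::real} \<and> (\<forall>t\<in>{0..1}. \<forall>x\<in>X. N (h (t, x)) \<le> B \<longrightarrow> t \<in> T \<and> N x \<le> B')" for B
      by (rule exI[of _ "{0..1::real}"], rule exI[of _ B]) (auto simp: N)
  qed auto
  have "homotopic_with (\<lambda>x. True) ?A ?A id (map_option id \<circ> map_option ?r)"
  proof (subst homotopic_with, blast, intro exI[of _ ?H] conjI H)
    show "\<forall>x\<in>topspace ?A. ?H (0, x) = id x" using h0 by auto
    show "\<forall>x\<in>topspace ?A. ?H (1, x) = (map_option id \<circ> map_option ?r) x" by auto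
  qed simp
  then show "homotopic_with (\<lambda>x. True) ?A ?A (map_option id \<circ> map_option ?r) id"
    by (rule homotopic_with_symD)
qed

section \<open>Collapses of cones\<close>

text \<open>The coordinate \<open>x 0\<close> is free, so this is a line times the open cone over the realization of
  \<open>K\<close>; the vertices of \<open>K\<close> are supposed to be positive.\<close>

definition line_cone :: "nat set set \<Rightarrow> (nat \<Rightarrow> real) set" where
  "line_cone K = {x. (\<forall>i>0. 0 \<le> x i) \<and> {i. 0 < i \<and> x i \<noteq> 0} \<in> K}"

text \<open>The exhausting function on the cone. Only \<open>x 0\<close> may be negative, so it
  alone gets an absolute value.\<close>

definition weight :: "nat \<Rightarrow> (nat \<Rightarrow> real) \<Rightarrow> real" where
  "weight n x = \<bar>x 0\<bar> + (\<Sum>i\<in>{0<..<n}. x i)"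

text \<open>Each vertex of \<open>\<sigma>\<close> gives away \<open>s\<close> and \<open>v\<close>
  receives the total, which explains the factor \<open>card \<sigma>\<close>: the sum of the
  coordinates is unchanged if \<open>\<sigma>\<close> is finite.\<close>

definition shift :: "nat set \<Rightarrow> nat \<Rightarrow> real \<Rightarrow> (nat \<Rightarrow> real) \<Rightarrow> nat \<Rightarrow> real" where
  "shift \<sigma> v s x i = x i - s * of_bool (i \<in> \<sigma>) + s * real (card \<sigma>) * of_bool (i = v)"

text \<open>On the cone the minimum is the largest amount that can be removed without a negative
  coordinate. It vanishes on points whose support does not contain \<open>\<sigma>\<close>, so one
  continuous formula fixes the rest of the complex.\<close>

abbreviation push :: "nat set \<Rightarrow> nat \<Rightarrow> real \<times> (nat \<Rightarrow> real) \<Rightarrow> nat \<Rightarrow> real" where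
  "push \<sigma> v \<equiv> \<lambda>(t, x). shift \<sigma> v (t * Min (x ` \<sigma>)) x"

lemma continuous_on_coord: "continuous_on S (\<lambda>x. x i)" for S :: "(nat \<Rightarrow> real) set"
  by (rule continuous_on_subset[OF continuous_on_product_coordinates]) simp

lemma continuous_on_Min_coords:
  fixes \<sigma> :: "nat set"
  assumes "finite \<sigma>" "\<sigma> \<noteq> {}"
  shows "continuous_on S (\<lambda>x. Min ((x :: nat \<Rightarrow> real) ` \<sigma>))"
  using assms
proof (induction \<sigma> rule: finite_ne_induct)
  case (insert i F)
  then have eq: "(\<lambda>x. Min ((x :: nat \<Rightarrow> real) ` insert i F)) = (\<lambda>x. min (x i) (Min (x ` F)))"
    by (intro ext) simp
  show ?case unfolding eq by (intro continuous_on_min continuous_on_coord insert.IH)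
qed (simp add: continuous_on_coord)

lemma continuous_on_push:
  assumes "finite \<sigma>" "\<sigma> \<noteq> {}"
  shows "continuous_on S (push \<sigma> v)"
proof (rule continuous_on_coordinatewise_then_product)
  fix i
  have c: "continuous_on S (\<lambda>z. snd z i)" "continuous_on S (\<lambda>z. Min (snd z ` \<sigma>))"
    for S :: "(real \<times> (nat \<Rightarrow> real)) set"
    using continuous_on_compose2[OF continuous_on_coord[of UNIV i] continuous_on_snd[OF continuous_on_id], of S]
      continuous_on_compose2[OF continuous_on_Min_coords[OF assms, of UNIV] continuous_on_snd[OF continuous_on_id], of S]
    by auto
  show "continuous_on S (\<lambda>z. push \<sigma> v z i)"
    unfolding shift_def case_prod_unfold by (intro continuous_intros c)
qed

lemma continuous_on_weight: "continuous_on S (weight n)"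
  unfolding weight_def[abs_def] by (intro continuous_intros continuous_on_coord)

lemma shift_0 [simp]: "shift \<sigma> v 0 x = x"
  by (simp add: shift_def fun_eq_iff)

lemma push_at_0: "0 \<notin> \<sigma> \<Longrightarrow> v \<noteq> 0 \<Longrightarrow> push \<sigma> v (t, x) 0 = x 0"
  by (simp add: shift_def)

lemma sum_push:
  assumes "insert v \<sigma> \<subseteq> {0<..<n}"
  shows "(\<Sum>i\<in>{0<..<n}. push \<sigma> v (t, x) i) = (\<Sum>i\<in>{0<..<n}. x i)"
proof -
  have "(\<Sum>i\<in>{0<..<n}. of_bool (i \<in> \<sigma>)) = real (card \<sigma>)" "(\<Sum>i\<in>{0<..<n}. of_bool (i = v)) = (1::real)"
    using assms by (auto simp: sum.If_cases of_bool_def Int_absorb1)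
  then show ?thesis
    by (simp add: shift_def sum.distrib sum_subtractf flip: sum_distrib_left)
qed

lemma weight_push:
  assumes "insert v \<sigma> \<subseteq> {0<..<n}"
  shows "weight n (push \<sigma> v (t, x)) = weight n x"
proof -
  have "push \<sigma> v (t, x) 0 = x 0" using assms by (intro push_at_0) auto
  then show ?thesis using sum_push[OF assms] by (simp only: weight_def)
qed

lemma line_cone_zero:
  assumes "x \<in> line_cone K" "K \<subseteq> Pow S" "0 < i" "i \<notin> S"
  shows "x i = 0"
  using assms by (auto simp: line_cone_def)

text \<open>If the minimum is positive, the support contains \<open>\<sigma>\<close>, and freeness
  confines it to \<open>insert v \<sigma>\<close> before and after the push. Otherwise nothing
  moves. At time 1 a vertex attaining the minimum has been emptied, so neither of the two removed
  faces can be the support.\<close>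

lemma push_line_cone:
  assumes K: "\<forall>F\<in>K. Pow F \<subseteq> K"
    and st: "\<sigma> \<noteq> {}" "v \<notin> \<sigma>" "insert v \<sigma> \<in> K" "insert v \<sigma> \<subseteq> {0<..<n}"
    and free: "\<forall>F\<in>K. \<sigma> \<subseteq> F \<longrightarrow> F = \<sigma> \<or> F = insert v \<sigma>"
    and x: "x \<in> line_cone K" and t: "t \<in> {0..1}"
  shows "push \<sigma> v (t, x) \<in> line_cone K" and "push \<sigma> v (1, x) \<in> line_cone (K - {\<sigma>, insert v \<sigma>})"
proof -
  define m where "m = Min (x ` \<sigma>)"
  have fin: "finite \<sigma>" using st(4) finite_subset by auto
  have mle: "m \<le> x i" if "i \<in> \<sigma>" for i using fin that by (simp add: m_def)
  have "m \<in> x ` \<sigma>" using fin st(1) by (simp add: m_def)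
  then obtain u where u: "u \<in> \<sigma>" "x u = m" by auto
  have u0: "0 < u" using u st(4) by auto
  have nonneg: "0 \<le> x i" if "0 < i" for i using x that by (simp add: line_cone_def)
  have m0: "0 \<le> m" using nonneg u u0 by auto
  define supp where "supp y = {i. 0 < i \<and> y i \<noteq> 0}" for y :: "nat \<Rightarrow> real"
  have lc: "y \<in> line_cone L \<longleftrightarrow> (\<forall>i>0. 0 \<le> y i) \<and> supp y \<in> L" for y L
    by (simp add: line_cone_def supp_def)
  have xK: "supp x \<in> K" using x by (simp add: lc)
  have eq: "push \<sigma> v (t, x) = shift \<sigma> v (t * m) x" for t by (simp add: m_def)
  have pos: "0 \<le> push \<sigma> v (t, x) i" if "0 < i" "t \<in> {0..1}" for t i
  proof -
    have "t * m \<le> m" "0 \<le> t * m" using that(2) m0 by (auto simp: mult_left_le_one_le)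
    then have "t * m * of_bool (i \<in> \<sigma>) \<le> x i" using mle[of i] nonneg[OF that(1)] by auto
    then show ?thesis unfolding eq shift_def using \<open>0 \<le> t * m\<close> by simp
  qed
  have sup: "supp (push \<sigma> v (t, x)) \<in> K" for t
  proof (cases "m = 0")
    case True
    then show ?thesis using xK unfolding eq by (simp add: shift_def[abs_def])
  next
    case False
    then have "\<sigma> \<subseteq> supp x" using mle m0 st(4) by (fastforce simp: supp_def)
    then have "supp x \<subseteq> insert v \<sigma>" using free xK by blast
    then have "supp (push \<sigma> v (t, x)) \<subseteq> insert v \<sigma>"
      unfolding eq by (auto simp: supp_def shift_def split: if_splits)
    then show ?thesis using K st(3) by blast
  qed
  show "push \<sigma> v (t, x) \<in> line_cone K" using pos t sup by (simp add: lc)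
  have "push \<sigma> v (1, x) u = 0" using u st(2) unfolding eq by (auto simp: shift_def)
  then have "u \<notin> supp (push \<sigma> v (1, x))" by (simp add: supp_def)
  then have "supp (push \<sigma> v (1, x)) \<notin> {\<sigma>, insert v \<sigma>}" using u(1) by auto
  then show "push \<sigma> v (1, x) \<in> line_cone (K - {\<sigma>, insert v \<sigma>})"
    using pos[of _ 1] sup[of 1] by (simp add: lc)
qed

text \<open>A finite union of closed cones, one for each face. A limit may lose coordinates of its
  support, which is where closure under subsets enters.\<close>

lemma closed_line_cone:
  assumes "finite K" and down: "\<forall>F\<in>K. Pow F \<subseteq> K"
  shows "closed (line_cone K)"
proof -
  have "line_cone K = (\<Union>F\<in>K. {x. \<forall>i>0. 0 \<le> x i \<and> (i \<notin> F \<longrightarrow> x i = 0)})"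
  proof (intro equalityI subsetI)
    fix x :: "nat \<Rightarrow> real" assume "x \<in> (\<Union>F\<in>K. {x. \<forall>i>0. 0 \<le> x i \<and> (i \<notin> F \<longrightarrow> x i = 0)})"
    then obtain F where F: "F \<in> K" "\<And>i. 0 < i \<Longrightarrow> 0 \<le> x i" "\<And>i. 0 < i \<Longrightarrow> i \<notin> F \<Longrightarrow> x i = 0" by auto
    then have "{i. 0 < i \<and> x i \<noteq> 0} \<subseteq> F" by auto
    then show "x \<in> line_cone K" using F down by (auto simp: line_cone_def)
  next
    fix x assume x: "x \<in> line_cone K"
    then have "x \<in> {x. \<forall>i>0. 0 \<le> x i \<and> (i \<notin> {i. 0 < i \<and> x i \<noteq> 0} \<longrightarrow> x i = 0)}"
      by (auto simp: line_cone_def)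
    then show "x \<in> (\<Union>F\<in>K. {x. \<forall>i>0. 0 \<le> x i \<and> (i \<notin> F \<longrightarrow> x i = 0)})"
      using x by (intro UN_I[of "{i. 0 < i \<and> x i \<noteq> 0}"]) (auto simp: line_cone_def)
  qed
  moreover have "closed {x :: nat \<Rightarrow> real. \<forall>i>0. 0 \<le> x i \<and> (i \<notin> F \<longrightarrow> x i = 0)}" for F
    by (intro closed_Collect_all closed_Collect_imp closed_Collect_conj closed_Collect_le closed_Collect_eq
        open_Collect_const continuous_on_coord continuous_on_const)
  ultimately show ?thesis using assms(1) by (simp add: closed_UN)
qed

lemma exhausts_line_cone:
  assumes "finite K" and down: "\<forall>F\<in>K. Pow F \<subseteq> K" and sub: "K \<subseteq> Pow {0<..<n}"
  shows "exhausts (line_cone K) (weight n)"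
  unfolding exhausts_def
proof (intro conjI allI continuous_on_weight)
  fix B :: real
  \<comment> \<open>A box in a countable product, compact by Tychonoff. It contains the sublevel set
    since the coordinates from \<open>n\<close> on vanish on the cone.\<close>
  define P where "P = (\<Pi>\<^sub>E i\<in>(UNIV::nat set). {-\<bar>B\<bar>..\<bar>B\<bar>})"
  have "compactin (product_topology (\<lambda>i. euclideanreal) UNIV) P"
    unfolding P_def compactin_PiE by simp
  then have P: "compact P" by (simp add: euclidean_product_topology)
  have "{x \<in> line_cone K. weight n x \<le> B} \<subseteq> P"
  proof
    fix x assume x: "x \<in> {x \<in> line_cone K. weight n x \<le> B}"
    have nonneg: "0 \<le> x i" if "0 < i" for i using x that by (simp add: line_cone_def)
    have z: "x i = 0" if "n \<le> i" "0 < i" for i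
      using line_cone_zero[of x K "{0<..<n}" i] x sub that by simp
    have s: "0 \<le> (\<Sum>i\<in>{0<..<n}. x i)" using nonneg by (intro sum_nonneg) auto
    have "\<bar>x i\<bar> \<le> B" for i
    proof -
      consider "i = 0" | "0 < i" "i < n" | "0 < i" "n \<le> i" by linarith
      then show ?thesis
      proof cases
        case 1
        then show ?thesis using x s by (simp add: weight_def)
      next
        case 2
        then have "x i \<le> (\<Sum>i\<in>{0<..<n}. x i)" using nonneg by (intro member_le_sum) auto
        then show ?thesis using x nonneg[OF 2(1)] by (simp add: weight_def) linarith
      next
        case 3
        then have "x i = 0" using z by simp
        then show ?thesis using x s by (simp add: weight_def) linarith
      qed
    qed
    then have "x i \<in> {-\<bar>B\<bar>..\<bar>B\<bar>}" for i by (smt (verit) atLeastAtMost_iff)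
    then show "x \<in> P" by (auto simp: P_def)
  qed
  moreover have "closed {x \<in> line_cone K. weight n x \<le> B}"
    by (intro closed_Collect_conj closed_Collect_le continuous_on_weight continuous_on_const)
      (use closed_line_cone[OF assms(1,2)] in auto)
  ultimately show "compact {x \<in> line_cone K. weight n x \<le> B}"
    using compact_Int_closed[OF P, of "{x \<in> line_cone K. weight n x \<le> B}"] by (simp only: inf.absorb2)
qed

lemma collapsible_props:
  assumes "collapsible K"
  shows "finite K" and "\<forall>F\<in>K. Pow F \<subseteq> K"
  using assms by (cases; auto)+

lemma contractible_Alexandroff_ray:
  assumes v: "v \<in> {0<..<n}"
  shows "contractible_space (Alexandroff_compactification (top_of_set (line_cone {{}, {v}})))"
proof -
  let ?X = "line_cone {{}, {v}}"
  let ?A = "Alexandroff_compactification (top_of_set ?X)"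
  \<comment> \<open>The amount \<open>t / (1 - t)\<close> grows from 0 to infinity on
    \<open>{0..<1}\<close>; time 1 is left out and corresponds to the point at infinity.\<close>
  define h where "h = (\<lambda>(t::real, x::nat \<Rightarrow> real) i. x i + t / (1 - t) * of_bool (i = v))"
  have X: "exhausts ?X (weight n)" by (rule exhausts_line_cone) (use v in auto)
  have hX: "h (t, x) \<in> ?X" if "t \<in> {0..<1}" "x \<in> ?X" for t x
  proof -
    have z: "x i = 0" if "0 < i" "i \<noteq> v" for i
      using line_cone_zero[of x "{{}, {v}}" "{v}" i] \<open>x \<in> ?X\<close> that by simp
    have "{i. 0 < i \<and> h (t, x) i \<noteq> 0} \<subseteq> {v}" using z by (auto simp: h_def)
    moreover have "0 \<le> h (t, x) i" if "0 < i" for i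
      using that \<open>x \<in> ?X\<close> \<open>t \<in> {0..<1}\<close> by (simp add: h_def line_cone_def)
    ultimately show ?thesis unfolding line_cone_def by blast
  qed
  have wt: "weight n (h (t, x)) = weight n x + t / (1 - t)" for t x
  proof -
    have "(\<Sum>i\<in>{0<..<n}. of_bool (i = v)) = (1::real)" using v by (simp add: of_bool_def)
    moreover have "(\<Sum>i\<in>{0<..<n}. h (t, x) i) =
        (\<Sum>i\<in>{0<..<n}. x i) + t / (1 - t) * (\<Sum>i\<in>{0<..<n}. of_bool (i = v))"
      by (simp only: h_def case_prod_conv sum.distrib sum_distrib_left)
    moreover have "h (t, x) 0 = x 0" using v by (simp add: h_def)
    ultimately show ?thesis by (simp only: weight_def mult_1_right add.assoc)
  qed
  have wx: "0 \<le> weight n x" if "x \<in> ?X" for x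
    using that by (auto simp: weight_def line_cone_def intro!: add_nonneg_nonneg sum_nonneg)
  let ?H = "\<lambda>z. if z \<in> {0..<1} \<times> Some ` ?X then Some (h (fst z, the (snd z))) else None"
  have H: "continuous_map (prod_topology (top_of_set {0..1}) ?A) ?A ?H"
  proof (rule continuous_map_homotopy_Alexandroff[where h = h and U = "{0..<1}", OF X _ _ _ continuous_on_weight])
    have "{0..<1} = {0..1} \<inter> {..<1::real}" by auto
    then show "openin (top_of_set {0..1}) {0..<1::real}" by (metis open_lessThan openin_open_Int)
    show "continuous_on ({0..<1} \<times> ?X) h"
    proof (rule continuous_on_coordinatewise_then_product)
      fix i
      have "continuous_on S (\<lambda>z. snd z i)" for S :: "(real \<times> (nat \<Rightarrow> real)) set"
        using continuous_on_compose2[OF continuous_on_coord[of UNIV i] continuous_on_snd[OF continuous_on_id], of S] by auto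
      then show "continuous_on ({0..<1} \<times> ?X) (\<lambda>z. h z i)"
        unfolding h_def case_prod_unfold by (intro continuous_intros) auto
    qed
    show "\<exists>T B'. compact T \<and> T \<subseteq> {0..<1} \<and>
        (\<forall>t\<in>{0..<1}. \<forall>x\<in>?X. weight n (h (t, x)) \<le> B \<longrightarrow> t \<in> T \<and> weight n x \<le> B')" for B
    \<comment> \<open>The end point solves \<open>t / (1 - t) = \<bar>B\<bar>\<close>.\<close>
    proof (rule exI[of _ "{0..\<bar>B\<bar> / (1 + \<bar>B\<bar>)}"], rule exI[of _ B], intro conjI ballI impI)
      have "\<bar>B\<bar> / (1 + \<bar>B\<bar>) < 1" by (simp add: pos_divide_less_eq)
      then show "{0..\<bar>B\<bar> / (1 + \<bar>B\<bar>)} \<subseteq> {0..<1}"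
        by (meson atLeastAtMost_iff atLeastLessThan_iff le_less_trans subsetI)
      fix t x assume tx: "t \<in> {0..<1::real}" "x \<in> ?X" "weight n (h (t, x)) \<le> B"
      then have "0 \<le> t / (1 - t)" by simp
      then show "weight n x \<le> B" using tx(3) unfolding wt by linarith
      have "t / (1 - t) \<le> \<bar>B\<bar>" using tx wt wx[OF tx(2)] by simp
      then have "t \<le> \<bar>B\<bar> * (1 - t)" using tx(1) by (simp add: pos_divide_le_eq)
      then have "t * (1 + \<bar>B\<bar>) \<le> \<bar>B\<bar>" by (simp add: algebra_simps)
      then have "t \<le> \<bar>B\<bar> / (1 + \<bar>B\<bar>)" by (subst pos_le_divide_eq) auto
      then show "t \<in> {0..\<bar>B\<bar> / (1 + \<bar>B\<bar>)}" using tx(1) by simp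
    qed auto
  qed (use hX in auto)
  have "homotopic_with (\<lambda>x. True) ?A ?A id (\<lambda>x. None)"
  proof (subst homotopic_with, blast, intro exI[of _ ?H] conjI H)
    show "\<forall>x\<in>topspace ?A. ?H (0, x) = id x" by (auto simp: h_def)
  qed auto
  then show ?thesis by (auto simp: contractible_space_def)
qed

theorem contractible_Alexandroff_line_cone:
  assumes "collapsible K" "K \<subseteq> Pow {0<..<n}"
  shows "contractible_space (Alexandroff_compactification (top_of_set (line_cone K)))"
  using assms
proof (induction K rule: collapsible.induct)
  case (point v)
  then show ?case by (intro contractible_Alexandroff_ray[of v n]) auto
next
  case (collapse K \<sigma> v)
  let ?K = "K - {\<sigma>, insert v \<sigma>}"
  have sub: "insert v \<sigma> \<subseteq> {0<..<n}" using collapse by auto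
  then have fin: "finite \<sigma>" using finite_subset by auto
  note p = push_line_cone[OF collapse.hyps(2-5) sub collapse.hyps(6)]
  show ?case
  proof (rule contractible_Alexandroff_by_retraction[where Y = "line_cone ?K" and h = "push \<sigma> v" and N = "weight n"])
    show "exhausts (line_cone K) (weight n)"
      using collapse.hyps(1,2) collapse.prems by (rule exhausts_line_cone)
    show "exhausts (line_cone ?K) (weight n)"
      by (rule exhausts_line_cone[OF collapsible_props[OF collapse.hyps(7)]]) (use collapse.prems in auto)
    show "continuous_on ({0..1} \<times> line_cone K) (push \<sigma> v)"
      by (rule continuous_on_push[OF fin collapse.hyps(3)])
    show "contractible_space (Alexandroff_compactification (top_of_set (line_cone ?K)))"
      using collapse.IH collapse.prems by blast
    show "push \<sigma> v ` ({0..1} \<times> line_cone K) \<subseteq> line_cone K" using p(1) by auto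
    show "push \<sigma> v (1, x) \<in> line_cone ?K" if "x \<in> line_cone K" for x
      using p(2)[OF that, of 1] by auto
    show "weight n (push \<sigma> v (t, x)) = weight n x" for t x by (rule weight_push[OF sub])
  qed (auto simp: line_cone_def)
qed

text \<open>The realization is a slice of the cone, and \<open>push\<close> preserves both equations
  defining it, so the same deformation serves both spaces.\<close>

lemma geometric_realization_line_cone:
  assumes "K \<subseteq> Pow {0<..<n}"
  shows "geometric_realization K =
    top_of_set {x \<in> line_cone K. x 0 = 0 \<and> (\<Sum>i\<in>{0<..<n}. x i) = 1}"
proof -
  have "(\<forall>v. 0 \<le> x v) \<and> {v. x v \<noteq> 0} \<in> K \<and> (\<Sum>v | x v \<noteq> 0. x v) = 1 \<longleftrightarrow>
    x \<in> line_cone K \<and> x 0 = 0 \<and> (\<Sum>i\<in>{0<..<n}. x i) = 1" for x :: "nat \<Rightarrow> real"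
  proof (cases "x 0 = 0")
    case True
    then have s: "{i. 0 < i \<and> x i \<noteq> 0} = {v. x v \<noteq> 0}" by (metis gr0I)
    have "(\<forall>v. 0 \<le> x v) \<longleftrightarrow> (\<forall>v>0. 0 \<le> x v)" using True by (metis gr0I order_refl)
    moreover have "(\<Sum>v | x v \<noteq> 0. x v) = (\<Sum>i\<in>{0<..<n}. x i)" if "{v. x v \<noteq> 0} \<in> K"
      using assms that by (intro sum.mono_neutral_left) auto
    ultimately show ?thesis using True s by (auto simp: line_cone_def)
  next
    case False
    have "{v. x v \<noteq> 0} \<notin> K"
    proof
      assume "{v. x v \<noteq> 0} \<in> K"
      then have "{v. x v \<noteq> 0} \<subseteq> {0<..<n}" using assms by blast
      then show False using False by auto
    qed
    then show ?thesis using False by blast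
  qed
  then show ?thesis by (simp add: geometric_realization_def)
qed

theorem contractible_geometric_realization:
  assumes "collapsible K" "K \<subseteq> Pow {0<..<n}"
  shows "contractible_space (geometric_realization K)" and "topspace (geometric_realization K) \<noteq> {}"
proof -
  define R where "R K = {x \<in> line_cone K. x 0 = 0 \<and> (\<Sum>i\<in>{0<..<n}. x i) = 1}" for K
  \<comment> \<open>Nonemptiness is carried along because \<open>contractible_space\<close> also
    holds for the empty space.\<close>
  have "contractible_space (top_of_set (R K)) \<and> R K \<noteq> {}"
    using assms
  proof (induction K rule: collapsible.induct)
    case (point v)
    define e :: "nat \<Rightarrow> real" where "e i = of_bool (i = v)" for i
    have v: "0 < v" "v < n" using point by auto
    have "x = e" if x: "x \<in> R {{}, {v}}" for x
    proof
      fix i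
      have z: "x j = 0" if "j \<noteq> v" for j
        using x that line_cone_zero[of x "{{}, {v}}" "{v}" j] by (cases "j = 0") (auto simp: R_def)
      then have "(\<Sum>i\<in>{0<..<n}. x i) = x v" using v by (intro sum.remove[of _ v, THEN trans]) auto
      then show "x i = e i" using x z by (auto simp: R_def e_def)
    qed
    then have "R {{}, {v}} \<subseteq> {e}" by blast
    then have c: "contractible_space (top_of_set (R {{}, {v}}))"
      by (intro contractible_space_subset_singleton[of _ e]) simp
    have "{i. 0 < i \<and> e i \<noteq> 0} = {v}" using v by (auto simp: e_def)
    moreover have "(\<Sum>i\<in>{0<..<n}. e i) = 1" using v by (simp add: e_def of_bool_def)
    moreover have "e 0 = 0" "\<forall>i. 0 \<le> e i" using v by (simp_all add: e_def)
    ultimately have "e \<in> R {{}, {v}}" by (simp add: R_def line_cone_def)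
    with c show ?case by blast
  next
    case (collapse K \<sigma> v)
    let ?K = "K - {\<sigma>, insert v \<sigma>}"
    have sub: "insert v \<sigma> \<subseteq> {0<..<n}" using collapse by auto
    then have fin: "finite \<sigma>" using finite_subset by auto
    note p = push_line_cone[OF collapse.hyps(2-5) sub collapse.hyps(6)]
    have IH: "contractible_space (top_of_set (R ?K))" "R ?K \<noteq> {}" using collapse.IH collapse.prems by blast+
    have RR: "R ?K \<subseteq> R K" by (auto simp: R_def line_cone_def)
    have at0: "push \<sigma> v (t, x) 0 = x 0" for t x using sub by (intro push_at_0) auto
    have p1: "push \<sigma> v (t, x) \<in> R K" if "t \<in> {0..1}" "x \<in> R K" for t x
      using p(1)[of x t] that sum_push[OF sub] at0 by (auto simp: R_def)
    have p2: "push \<sigma> v (1, x) \<in> R ?K" if "x \<in> R K" for x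
      using p(2)[of x 1] that sum_push[OF sub, of 1 x] at0[of 1 x] by (simp add: R_def)
    have c: "continuous_on S (push \<sigma> v)" for S by (rule continuous_on_push[OF fin collapse.hyps(3)])
    have "contractible_space (top_of_set (R K))"
    proof (rule homotopy_dominated_contractibility[OF _ _ _ IH(1)])
      show "continuous_map (top_of_set (R ?K)) (top_of_set (R K)) id" using RR by auto
      have "continuous_on (R K) (\<lambda>x. push \<sigma> v (1, x))"
        by (rule continuous_on_compose2[OF c[of UNIV]]) (auto intro!: continuous_intros)
      then show "continuous_map (top_of_set (R K)) (top_of_set (R ?K)) (\<lambda>x. push \<sigma> v (1, x))"
        using p2 by auto
      have "homotopic_with (\<lambda>x. True) (top_of_set (R K)) (top_of_set (R K)) id (id \<circ> (\<lambda>x. push \<sigma> v (1, x)))"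
      proof (subst homotopic_with, blast, intro exI[of _ "push \<sigma> v"] conjI)
        show "continuous_map (prod_topology (top_of_set {0..1}) (top_of_set (R K))) (top_of_set (R K)) (push \<sigma> v)"
          using c p1 by auto
      qed auto
      then show "homotopic_with (\<lambda>x. True) (top_of_set (R K)) (top_of_set (R K)) (id \<circ> (\<lambda>x. push \<sigma> v (1, x))) id"
        by (rule homotopic_with_symD)
    qed
    then show ?case using IH(2) RR by blast
  qed
  then show "contractible_space (geometric_realization K)" "topspace (geometric_realization K) \<noteq> {}"
    unfolding geometric_realization_line_cone[OF assms(2)] R_def by auto
qed

section \<open>Polynomials and the gaps between their roots\<close>

text \<open>For \<open>x\<close> in a \<open>line_cone\<close>, \<open>x 0\<close> is the smallest root and \<open>x i\<close> the gap before the root number \<open>i\<close>,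
  counted from \<open>0\<close>. The support of the gaps is the set of cuts of the multiplicities.\<close>

definition root_at :: "(nat \<Rightarrow> real) \<Rightarrow> nat \<Rightarrow> real" where
  "root_at x j = (\<Sum>i\<le>j. x i)"

definition root_poly :: "nat \<Rightarrow> (nat \<Rightarrow> real) \<Rightarrow> real poly" where
  "root_poly n x = (\<Prod>j<n. [:- root_at x j, 1:])"

lemma topspace_monic_real_rooted:
  "topspace (monic_real_rooted n) = {f. degree f = n \<and> lead_coeff f = 1 \<and>
     (\<forall>z::complex. poly (map_poly complex_of_real f) z = 0 \<longrightarrow> z \<in> \<real>)}"
  by (simp add: monic_real_rooted_def topspace_pullback_topology)

lemma poly_map_poly_of_real_mult_linear:
  "poly (map_poly complex_of_real ([:- r, 1:] * q)) z =
    (z - of_real r) * poly (map_poly complex_of_real q) z"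
proof -
  have "map_poly complex_of_real ([:- r, 1:] * q) =
      [:- of_real r, 1:] * map_poly complex_of_real q"
    by (intro poly_eqI) (simp add: coeff_map_poly coeff_pCons split: nat.splits)
  then show ?thesis by (simp only: poly_mult) simp
qed

lemma degree_root_poly: "degree (root_poly n x) = n"
  and lead_coeff_root_poly: "lead_coeff (root_poly n x) = 1"
  by (simp_all only: root_poly_def lead_coeff_prod) (simp_all add: degree_prod_sum_eq)

lemma root_poly_in_topspace: "root_poly n x \<in> topspace (monic_real_rooted n)"
proof -
  have "z \<in> \<real>" if "poly (map_poly complex_of_real (root_poly n x)) z = 0" for z
    using that
  proof (induction n)
    case 0
    then show ?case by (simp add: root_poly_def)
  next
    case (Suc n)
    have "root_poly (Suc n) x = [:- root_at x n, 1:] * root_poly n x"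
      by (simp add: root_poly_def mult.commute)
    then have "(z - of_real (root_at x n)) * poly (map_poly complex_of_real (root_poly n x)) z = 0"
      using Suc.prems by (metis poly_map_poly_of_real_mult_linear)
    then show ?case using Suc.IH by auto
  qed
  then show ?thesis
    using degree_root_poly lead_coeff_root_poly by (auto simp: topspace_monic_real_rooted)
qed

lemma continuous_on_coeff_root_poly: "continuous_on S (\<lambda>x. coeff (root_poly n x))"
proof (rule continuous_on_coordinatewise_then_product)
  show "continuous_on S (\<lambda>x. coeff (root_poly n x) k)" for k
  proof (induction n arbitrary: k)
    case 0
    then show ?case by (simp add: root_poly_def)
  next
    case (Suc n)
    have "root_poly (Suc n) x = [:- root_at x n, 1:] * root_poly n x" for x
      by (simp add: root_poly_def mult.commute)
    then have "coeff (root_poly (Suc n) x) k =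
        - root_at x n * coeff (root_poly n x) k + (if k = 0 then 0 else coeff (root_poly n x) (k - 1))" for x
      by (simp add: coeff_pCons split: nat.splits)
    moreover have "continuous_on S (\<lambda>x. root_at x n)"
      unfolding root_at_def by (intro continuous_on_sum continuous_on_coord)
    then have "continuous_on S (\<lambda>x. - root_at x n * coeff (root_poly n x) k +
        (if k = 0 then 0 else coeff (root_poly n x) (k - 1)))"
      by (cases "k = 0") (auto intro!: continuous_intros Suc.IH)
    ultimately show ?case by simp
  qed
qed

lemma continuous_map_root_poly: "continuous_map (top_of_set S) (monic_real_rooted n) (root_poly n)"
  unfolding monic_real_rooted_def
proof (rule continuous_map_pullback')
  show "continuous_map (top_of_set S) euclidean (coeff \<circ> root_poly n)"
    using continuous_on_coeff_root_poly by (simp add: o_def)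
  show "topspace (top_of_set S) \<subseteq> root_poly n -`
      {f. degree f = n \<and> lead_coeff f = 1 \<and>
        (\<forall>z::complex. poly (map_poly complex_of_real f) z = 0 \<longrightarrow> z \<in> \<real>)}"
    using root_poly_in_topspace[of n] unfolding topspace_monic_real_rooted by blast
qed

lemma continuous_map_coeff: "continuous_map (monic_real_rooted n) euclidean coeff"
  unfolding monic_real_rooted_def
  using continuous_map_pullback[OF continuous_map_id, of _ coeff euclidean] by simp

section \<open>Bounded coefficients force bounded roots\<close>

lemma root_bound:
  fixes f :: "real poly"
  assumes f: "degree f = n" "lead_coeff f = 1" and B: "\<And>k. k < n \<Longrightarrow> \<bar>coeff f k\<bar> \<le> B"
    and r: "poly f r = 0"
  shows "\<bar>r\<bar> \<le> max 1 (real n * B)"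
proof (rule ccontr)
  assume "\<not> ?thesis"
  then have r1: "1 < \<bar>r\<bar>" and rB: "real n * B < \<bar>r\<bar>" by auto
  have n: "0 < n"
  proof (rule ccontr)
    assume "\<not> 0 < n"
    then show False using f r by (auto elim!: degree_eq_zeroE)
  qed
  \<comment> \<open>Since \<open>\<bar>r\<bar> > 1\<close>, the lower terms add up to at most
    \<open>n * B * \<bar>r\<bar> ^ (n - 1)\<close>, too little to cancel the leading term.\<close>
  have "0 = (\<Sum>k<n. coeff f k * r ^ k) + r ^ n"
    using r f by (simp add: poly_altdef flip: lessThan_Suc_atMost)
  then have "\<bar>r\<bar> ^ n = \<bar>\<Sum>k<n. coeff f k * r ^ k\<bar>"
    by (metis abs_minus_cancel add_eq_0_iff power_abs)
  also have "\<dots> \<le> (\<Sum>k<n. \<bar>coeff f k * r ^ k\<bar>)" by (rule sum_abs)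
  also have "\<dots> \<le> (\<Sum>k<n. B * \<bar>r\<bar> ^ (n - 1))"
  proof (rule sum_mono)
    fix k assume k: "k \<in> {..<n}"
    have "\<bar>r\<bar> ^ k \<le> \<bar>r\<bar> ^ (n - 1)" using r1 k by (intro power_increasing) auto
    moreover have "0 \<le> B" using B[of k] k by auto
    ultimately show "\<bar>coeff f k * r ^ k\<bar> \<le> B * \<bar>r\<bar> ^ (n - 1)"
      using B[of k] k unfolding abs_mult power_abs by (intro mult_mono) auto
  qed
  also have "\<dots> = real n * B * \<bar>r\<bar> ^ (n - 1)" by simp
  also have "\<dots> < \<bar>r\<bar> * \<bar>r\<bar> ^ (n - 1)" using rB r1 by (intro mult_strict_right_mono) auto
  also have "\<dots> = \<bar>r\<bar> ^ n" using n by (cases n) auto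
  finally show False by simp
qed

lemma poly_root_poly: "j < n \<Longrightarrow> poly (root_poly n x) (root_at x j) = 0"
  by (auto simp: root_poly_def poly_prod intro!: prod_zero)

text \<open>The weight is \<open>\<bar>root_at x 0\<bar> + root_at x (n - 1) - root_at x 0\<close>;
  bounding its three terms separately gives the factor 3.\<close>

lemma weight_le_if_coeff_le:
  assumes n: "0 < n" and B: "\<And>k. k < n \<Longrightarrow> \<bar>coeff (root_poly n x) k\<bar> \<le> B"
  shows "weight n x \<le> 3 * max 1 (real n * B)"
proof -
  have b: "\<bar>root_at x j\<bar> \<le> max 1 (real n * B)" if "j < n" for j
    using root_bound[OF degree_root_poly lead_coeff_root_poly B poly_root_poly[OF that]] by simp
  have "{..n - 1} = insert 0 {0<..<n}" using n by auto
  then have "root_at x (n - 1) = x 0 + (\<Sum>i\<in>{0<..<n}. x i)" by (simp add: root_at_def)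
  moreover have "root_at x 0 = x 0" by (simp add: root_at_def)
  ultimately have "weight n x = \<bar>root_at x 0\<bar> + (root_at x (n - 1) - root_at x 0)"
    by (simp add: weight_def)
  then show ?thesis using b[of 0] b[of "n - 1"] n by linarith
qed

text \<open>A convergent sequence of coefficients is bounded, hence its preimages lie in a compact
  sublevel set of the weight, and the image of a compact set is closed.\<close>

lemma closed_coeff_root_poly_image:
  assumes n: "0 < n" and X: "exhausts X (weight n)" and C: "closed C" "C \<subseteq> X"
  shows "closed ((\<lambda>x. coeff (root_poly n x)) ` C)"
  unfolding closed_sequential_limits
proof (intro allI impI)
  let ?E = "\<lambda>x. coeff (root_poly n x)"
  fix y l assume yl: "(\<forall>m. y m \<in> ?E ` C) \<and> y \<longlonglongrightarrow> l"
  have "\<exists>B. \<forall>m. \<bar>y m k\<bar> \<le> B" for k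
  proof -
    have "(\<lambda>m. y m k) \<longlonglongrightarrow> l k"
      using continuous_on_tendsto_compose[OF continuous_on_coord[of UNIV k], of y l sequentially] yl by simp
    then have "Bseq (\<lambda>m. y m k)" by (intro convergent_imp_Bseq convergentI)
    then show ?thesis by (auto simp: Bseq_def)
  qed
  then obtain b where b: "\<And>k m. \<bar>y m k\<bar> \<le> b k" by metis
  define B where "B = Max (b ` {..<n})"
  have B: "\<bar>y m k\<bar> \<le> B" if "k < n" for m k
  proof -
    have "b k \<le> B" unfolding B_def using that by (intro Max_ge) auto
    then show ?thesis using b[where k = k and m = m] by linarith
  qed
  define Q where "Q = {x \<in> X. weight n x \<le> 3 * max 1 (real n * B)}"
  have "compact (Q \<inter> C)" using X C(1) by (auto simp: Q_def exhausts_def intro!: compact_Int_closed)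
  then have "closed (?E ` (Q \<inter> C))"
    by (intro compact_imp_closed compact_continuous_image continuous_on_coeff_root_poly)
  moreover have "y m \<in> ?E ` (Q \<inter> C)" for m
  proof -
    obtain x where x: "x \<in> C" "y m = ?E x" using yl by blast
    then have "weight n x \<le> 3 * max 1 (real n * B)"
      using weight_le_if_coeff_le[OF n] B by metis
    then show ?thesis using x C(2) by (auto simp: Q_def)
  qed
  ultimately have "l \<in> ?E ` (Q \<inter> C)" using yl by (meson closed_sequentially)
  then show "l \<in> ?E ` C" by blast
qed

lemma proots_root_poly: "proots (root_poly n x) = mset (map (root_at x) [0..<n])"
proof (induction n)
  case (Suc n)
  have "root_poly (Suc n) x = root_poly n x * [:- root_at x n, 1:]" by (simp add: root_poly_def)
  moreover have "root_poly n x \<noteq> 0" using lead_coeff_root_poly[of n x] by auto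
  ultimately have "proots (root_poly (Suc n) x) = proots (root_poly n x) + proots [:- root_at x n, 1:]"
    by (metis pCons_eq_0_iff proots_mult zero_neq_one)
  then show ?case using Suc by simp
qed (simp add: root_poly_def)

text \<open>Nonnegative gaps list the roots in increasing order, so the multiset of roots determines
  the list, and differences recover the gaps.\<close>

lemma inj_on_root_poly:
  assumes K: "K \<subseteq> Pow {0<..<n}" and n: "0 < n"
  shows "inj_on (root_poly n) (line_cone K)"
proof (rule inj_onI)
  fix x y assume x: "x \<in> line_cone K" and y: "y \<in> line_cone K" and eq: "root_poly n x = root_poly n y"
  have sorted: "sorted (map (root_at z) [0..<n])" if "z \<in> line_cone K" for z
    unfolding sorted_iff_nth_mono
  proof (intro allI impI)
    fix i j assume ij: "i \<le> j" "j < length (map (root_at z) [0..<n])"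
    have "root_at z i \<le> root_at z j"
      unfolding root_at_def using ij that by (intro sum_mono2) (auto simp: line_cone_def)
    then show "map (root_at z) [0..<n] ! i \<le> map (root_at z) [0..<n] ! j" using ij by simp
  qed
  have "map (root_at x) [0..<n] = map (root_at y) [0..<n]"
    using properties_for_sort[OF _ sorted[OF x]] properties_for_sort[OF _ sorted[OF y]]
      proots_root_poly[of n x] proots_root_poly[of n y] eq by metis
  then have r: "root_at x j = root_at y j" if "j < n" for j
    using that by (metis add_0 diff_zero length_upt nth_map nth_upt)
  show "x = y"
  proof
    fix i
    consider "i = 0" | j where "i = Suc j" "i < n" | "0 < i" "n \<le> i"
      by (cases i; cases "i < n") auto
    then show "x i = y i"
    proof cases
      case 1
      then show ?thesis using r[of 0] n by (simp add: root_at_def)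
    next
      case 2
      then show ?thesis using r[of j] r[of i] by (simp add: root_at_def)
    next
      case 3
      then show ?thesis
        using line_cone_zero[OF x K, of i] line_cone_zero[OF y K, of i] by simp
    qed
  qed
qed

context
  fixes n :: nat and K :: "nat set set"
  assumes n: "0 < n" and K: "finite K" "\<forall>F\<in>K. Pow F \<subseteq> K" "K \<subseteq> Pow {0<..<n}"
begin

lemma closedin_root_poly_image:
  assumes "closed C" "C \<subseteq> line_cone K"
  shows "closedin (monic_real_rooted n) (root_poly n ` C)"
proof -
  have "closed ((\<lambda>x. coeff (root_poly n x)) ` C)"
    by (rule closed_coeff_root_poly_image[OF n exhausts_line_cone[OF K] assms])
  then have "closedin (monic_real_rooted n)
      {f \<in> topspace (monic_real_rooted n). coeff f \<in> (\<lambda>x. coeff (root_poly n x)) ` C}"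
    using continuous_map_coeff by (intro closedin_continuous_map_preimage) auto
  moreover have "{f \<in> topspace (monic_real_rooted n). coeff f \<in> (\<lambda>x. coeff (root_poly n x)) ` C} = root_poly n ` C"
    using root_poly_in_topspace by (auto simp: coeff_inject)
  ultimately show ?thesis by simp
qed

lemma homeomorphic_map_root_poly:
  "homeomorphic_map (top_of_set (line_cone K))
    (subtopology (monic_real_rooted n) (root_poly n ` line_cone K)) (root_poly n)"
proof (rule bijective_closed_imp_homeomorphic_map)
  show "continuous_map (top_of_set (line_cone K))
     (subtopology (monic_real_rooted n) (root_poly n ` line_cone K)) (root_poly n)"
    using continuous_map_root_poly by (simp add: continuous_map_in_subtopology)
  show "closed_map (top_of_set (line_cone K))
     (subtopology (monic_real_rooted n) (root_poly n ` line_cone K)) (root_poly n)"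
    unfolding closed_map_def
  proof (intro allI impI)
    fix C assume "closedin (top_of_set (line_cone K)) C"
    then have "closed C" "C \<subseteq> line_cone K"
      using closed_line_cone[OF K(1,2)] closedin_closed_trans closedin_imp_subset by blast+
    then show "closedin (subtopology (monic_real_rooted n) (root_poly n ` line_cone K)) (root_poly n ` C)"
      using closedin_root_poly_image by (intro closedin_subset_topspace) auto
  qed
  show "root_poly n ` topspace (top_of_set (line_cone K)) =
      topspace (subtopology (monic_real_rooted n) (root_poly n ` line_cone K))"
    using root_poly_in_topspace by auto
  show "inj_on (root_poly n) (topspace (top_of_set (line_cone K)))"
    using inj_on_root_poly[OF K(3) n] by simp
qed

end

section \<open>Strata, their gap coordinates and their closures\<close>

lemma root_at_consec:
  assumes con: "consec n C s e" and x: "\<forall>i>0. i \<notin> C \<longrightarrow> x i = 0"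
  shows "s \<le> j \<Longrightarrow> j < e \<Longrightarrow> root_at x j = root_at x s" and "root_at x e = root_at x s + x e"
proof -
  have se: "s < e" using con by (simp add: consec_def)
  show *: "root_at x j = root_at x s" if "s \<le> j" "j < e" for j
    using that
  proof (induction j rule: dec_induct)
    case (step j)
    then have "Suc j \<notin> C" using con by (auto simp: consec_def)
    then have "x (Suc j) = 0" using x by simp
    then show ?case using step by (simp add: root_at_def)
  qed simp
  have "root_at x e = root_at x (e - 1) + x e" using se by (cases e) (auto simp: root_at_def)
  then show "root_at x e = root_at x s + x e" using *[of "e - 1"] se by simp
qed

lemma root_poly_blocks:
  assumes b: "composition n b"
    and r: "\<And>k j. k < length b \<Longrightarrow> sum_list (take k b) \<le> j \<Longrightarrow> j < sum_list (take k b) + b ! k \<Longrightarrow>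
      root_at x j = r ! k"
  shows "root_poly n x = (\<Prod>k<length b. [:- (r ! k), 1:] ^ (b ! k))"
proof -
  have "(\<Prod>j<sum_list (take m b). [:- root_at x j, 1:]) = (\<Prod>k<m. [:- (r ! k), 1:] ^ (b ! k))"
    if "m \<le> length b" for m
    using that
  proof (induction m)
    case (Suc m)
    let ?s = "sum_list (take m b)"
    have e: "sum_list (take (Suc m) b) = ?s + b ! m" using Suc.prems by (simp add: take_Suc_conv_app_nth)
    have "(\<Prod>j<?s + b ! m. [:- root_at x j, 1:]) =
        (\<Prod>j<?s. [:- root_at x j, 1:]) * (\<Prod>j\<in>{?s..<?s + b ! m}. [:- root_at x j, 1:])"
      by (metis atLeast0LessThan le_add1 prod.atLeastLessThan_concat zero_le)
    also have "(\<Prod>j\<in>{?s..<?s + b ! m}. [:- root_at x j, 1:]) = (\<Prod>j\<in>{?s..<?s + b ! m}. [:- (r ! m), 1:])"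
      using r[of m] Suc.prems by (intro prod.cong) auto
    finally show ?case using Suc by (simp add: e)
  qed simp
  from this[of "length b"] show ?thesis using b by (simp add: root_poly_def composition_def)
qed

text \<open>The points whose polynomial lies in the stratum itself: the gaps are positive exactly at
  the cuts of some arrangement \<open>b\<close> of the multiplicities.\<close>

definition generic :: "nat multiset \<Rightarrow> (nat \<Rightarrow> real) set" where
  "generic L = {x. (\<forall>i>0. 0 \<le> x i) \<and> (\<exists>b. mset b = L \<and> {i. 0 < i \<and> x i \<noteq> 0} = cuts b)}"

lemma composition_mset: "number_partition n L \<Longrightarrow> mset b = L \<Longrightarrow> composition n b"
  by (auto simp: number_partition_def composition_def sum_mset_sum_list)

lemma root_poly_generic:
  assumes L: "number_partition n L" and n: "0 < n"
  shows "root_poly n ` generic L = stratum L"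
proof (intro equalityI subsetI)
  fix f assume "f \<in> root_poly n ` generic L"
  then obtain x b where x: "\<And>i. 0 < i \<Longrightarrow> 0 \<le> x i" "{i. 0 < i \<and> x i \<noteq> 0} = cuts b"
    and b: "mset b = L" and f: "f = root_poly n x" by (auto simp: generic_def)
  have comp: "composition n b" by (rule composition_mset[OF L b])
  define s where "s k = sum_list (take k b)" for k
  have con: "consec n (cuts b) (s k) (s k + b ! k)" if "k < length b" for k
    using that by (auto simp: consec_cuts_iff[OF comp n] s_def)
  have x0: "\<forall>i>0. i \<notin> cuts b \<longrightarrow> x i = 0" using x(2) by blast
  define r where "r = map (\<lambda>k. root_at x (s k)) [0..<length b]"
  have fr: "f = (\<Prod>k<length b. [:- (r ! k), 1:] ^ (b ! k))"
    unfolding f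
  proof (rule root_poly_blocks[OF comp])
    fix k j assume k: "k < length b" and "sum_list (take k b) \<le> j" "j < sum_list (take k b) + b ! k"
    then have "root_at x j = root_at x (s k)"
      by (intro root_at_consec(1)[OF con[OF k] x0]) (simp_all add: s_def)
    then show "root_at x j = r ! k" using k by (simp add: r_def)
  qed
  have "r ! k < r ! Suc k" if k: "Suc k < length b" for k
  proof -
    have "s k + b ! k = s (Suc k)" using k by (simp add: s_def take_Suc_conv_app_nth)
    moreover have "cuts b = s ` {0<..<length b}" by (auto simp: cuts_def s_def sum_list_take_nth)
    then have "s (Suc k) \<in> cuts b" using k by simp
    then have "s (Suc k) \<in> {i. 0 < i \<and> x i \<noteq> 0}" by (simp only: x(2))
    then have "0 < x (s (Suc k))" using x(1)[of "s (Suc k)"] by simp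
    ultimately show ?thesis using root_at_consec(2)[OF con x0, of k] k by (simp add: r_def)
  qed
  then have "sorted_wrt (<) r"
    by (subst sorted_wrt_iff_nth_Suc_transp) (auto simp: r_def)
  moreover have "length r = length b" by (simp add: r_def)
  ultimately show "f \<in> stratum L" unfolding stratum_def using fr b by blast
next
  fix f assume "f \<in> stratum L"
  then obtain r b where len: "length r = length b" and sorted: "sorted_wrt (<) r" and b: "mset b = L"
    and f: "f = (\<Prod>k<length b. [:- (r ! k), 1:] ^ (b ! k))" unfolding stratum_def by blast
  have comp: "composition n b" by (rule composition_mset[OF L b])
  define s where "s k = sum_list (take k b)" for k
  have s0: "s 0 = 0" by (simp add: s_def)
  have sS: "s k + b ! k = s (Suc k)" if "k < length b" for k
    using that by (simp add: s_def take_Suc_conv_app_nth)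
  have cut: "cuts b = s ` {0<..<length b}" by (auto simp: cuts_def s_def sum_list_take_nth)
  have smono: "s j < s k" if "j < k" "k \<le> length b" for j k
    using composition_psum_less[OF comp that] that by (simp add: s_def sum_list_take_nth)
  have inj: "inj_on s {0<..<length b}"
    by (rule linorder_inj_onI') (use smono in \<open>auto simp: less_imp_neq\<close>)
  \<comment> \<open>The gap at the cut \<open>s k\<close> is the distance from
    \<open>r ! (k - 1)\<close> to \<open>r ! k\<close>; inverting \<open>s\<close> recovers
    \<open>k\<close> from the cut.\<close>
  define x where "x i = (if i = 0 then r ! 0 else if i \<in> cuts b then
      r ! (inv_into {0<..<length b} s i) - r ! (inv_into {0<..<length b} s i - 1) else 0)" for i
  have xs: "x (s (Suc k)) = r ! Suc k - r ! k" if "Suc k < length b" for k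
  proof -
    have "inv_into {0<..<length b} s (s (Suc k)) = Suc k" using inj that by (intro inv_into_f_f) auto
    moreover have "s (Suc k) \<in> cuts b" "0 < s (Suc k)" using that smono[of 0 "Suc k"] s0 by (auto simp: cut)
    ultimately show ?thesis by (simp add: x_def)
  qed
  have inc: "r ! k < r ! Suc k" if "Suc k < length b" for k
    using sorted len that by (simp add: sorted_wrt_nth_less)
  have x0: "\<forall>i>0. i \<notin> cuts b \<longrightarrow> x i = 0" by (simp add: x_def)
  have xpos: "0 < x i" if i: "i \<in> cuts b" for i
  proof -
    obtain k where "0 < k" "k < length b" "i = s k" using i by (auto simp: cut)
    then show ?thesis using xs[of "k - 1"] inc[of "k - 1"] by simp
  qed
  have con: "consec n (cuts b) (s k) (s k + b ! k)" if "k < length b" for k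
    using that by (auto simp: consec_cuts_iff[OF comp n] s_def)
  have rs: "root_at x (s k) = r ! k" if "k < length b" for k
    using that
  proof (induction k)
    case 0
    then show ?case by (simp add: s0 root_at_def x_def)
  next
    case (Suc k)
    then have "root_at x (s (Suc k)) = root_at x (s k) + x (s (Suc k))"
      using root_at_consec(2)[OF con x0, of k] sS[of k] by simp
    then show ?case using Suc xs[of k] by simp
  qed
  have "root_poly n x = f" unfolding f
  proof (rule root_poly_blocks[OF comp])
    fix k j assume k: "k < length b" and "sum_list (take k b) \<le> j" "j < sum_list (take k b) + b ! k"
    then have "root_at x j = root_at x (s k)"
      by (intro root_at_consec(1)[OF con[OF k] x0]) (simp_all add: s_def)
    then show "root_at x j = r ! k" using rs[OF k] by simp
  qed
  moreover have "{i. 0 < i \<and> x i \<noteq> 0} = cuts b"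
  proof (intro equalityI subsetI)
    fix i assume "i \<in> {i. 0 < i \<and> x i \<noteq> 0}"
    then show "i \<in> cuts b" using x0 by blast
  next
    fix i assume i: "i \<in> cuts b"
    then have "0 < i" using cuts_subset[OF comp] by auto
    then show "i \<in> {i. 0 < i \<and> x i \<noteq> 0}" using xpos[OF i] by simp
  qed
  moreover have "0 \<le> x i" if "0 < i" for i using x0 xpos that by (cases "i \<in> cuts b") (auto intro: less_imp_le)
  ultimately show "f \<in> root_poly n ` generic L" using b by (auto simp: generic_def)
qed

lemma generic_subset:
  assumes L: "number_partition n L"
  shows "generic L \<subseteq> line_cone (delta L)"
proof
  fix x assume "x \<in> generic L"
  then obtain b where x: "\<forall>i>0. 0 \<le> x i" and b: "mset b = L" "{i. 0 < i \<and> x i \<noteq> 0} = cuts b"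
    by (auto simp: generic_def)
  have comp: "composition n b" by (rule composition_mset[OF L b(1)])
  have "b \<in> D_poset L"
    using comp comp_le_iff_cuts[OF comp comp] L b(1)
    by (auto simp: D_poset_def number_partition_def)
  then show "x \<in> line_cone (delta L)" using x b by (auto simp: line_cone_def delta_def)
qed

lemma line_cone_subset_closure_generic:
  assumes L: "number_partition n L"
  shows "line_cone (delta L) \<subseteq> closure (generic L)"
proof
  fix x assume x: "x \<in> line_cone (delta L)"
  then obtain a b where a: "composition n a" "{i. 0 < i \<and> x i \<noteq> 0} = cuts a"
    and b: "mset b = L" "comp_le a b"
    using L by (auto simp: line_cone_def delta_def D_poset_def number_partition_def)
  have comp: "composition n b" by (rule composition_mset[OF L b(1)])
  have sub: "cuts a \<subseteq> cuts b" using comp_le_iff_cuts[OF a(1) comp] b(2) by simp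
  have zero: "0 \<notin> cuts b" using cuts_subset[OF comp] by auto
  have nonneg: "0 \<le> x i" if "0 < i" for i using x that by (simp add: line_cone_def)
  \<comment> \<open>Opening every cut of \<open>b\<close> by \<open>e\<close> makes the point
    generic, because the support of \<open>x\<close> already lies in \<open>cuts b\<close>; then
    \<open>e\<close> tends to 0.\<close>
  define g where "g e i = x i + e * of_bool (i \<in> cuts b)" for e :: real and i
  have "g e \<in> generic L" if "0 < e" for e
  proof -
    have "{i. 0 < i \<and> g e i \<noteq> 0} = cuts b"
    proof (intro equalityI subsetI)
      fix i assume "i \<in> cuts b"
      moreover then have "0 < i" using zero by (metis gr0I)
      ultimately show "i \<in> {i. 0 < i \<and> g e i \<noteq> 0}" using nonneg[of i] that by (simp add: g_def)
    qed (use sub a(2) in \<open>auto simp: g_def split: if_splits\<close>)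
    then show ?thesis using nonneg that b(1) by (auto simp: generic_def g_def intro!: exI[of _ b])
  qed
  then have "g ` {0<..} \<subseteq> closure (generic L)" using closure_subset by auto
  moreover have "continuous_on (closure {0<..}) g"
    unfolding g_def by (intro continuous_on_coordinatewise_then_product continuous_intros)
  ultimately have "g ` closure {0<..} \<subseteq> closure (generic L)"
    by (intro image_closure_subset) auto
  then have "g 0 \<in> closure (generic L)" by auto
  moreover have "g 0 = x" by (simp add: g_def fun_eq_iff)
  ultimately show "x \<in> closure (generic L)" by simp
qed

text \<open>One inclusion holds because the image of the cone is closed, the other because generic
  points are dense in the cone and \<open>root_poly\<close> is continuous.\<close>

theorem closure_of_stratum:
  assumes L: "number_partition n L" and n: "0 < n"
  shows "monic_real_rooted n closure_of stratum L = root_poly n ` line_cone (delta L)"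
proof
  have K: "finite (delta L)" "\<forall>F\<in>delta L. Pow F \<subseteq> delta L" "delta L \<subseteq> Pow {0<..<n}"
    using delta_subset[OF L] delta_down_closed[OF L] finite_subset[OF delta_subset[OF L]] by auto
  show "monic_real_rooted n closure_of stratum L \<subseteq> root_poly n ` line_cone (delta L)"
  proof (rule closure_of_minimal)
    show "stratum L \<subseteq> root_poly n ` line_cone (delta L)"
      using root_poly_generic[OF L n] generic_subset[OF L] by blast
    show "closedin (monic_real_rooted n) (root_poly n ` line_cone (delta L))"
      by (intro closedin_root_poly_image[OF n K] closed_line_cone K) auto
  qed
  have "top_of_set (line_cone (delta L)) closure_of generic L = line_cone (delta L)"
    using line_cone_subset_closure_generic[OF L] generic_subset[OF L]
    by (auto simp: closure_of_subtopology inf.absorb2)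
  then show "root_poly n ` line_cone (delta L) \<subseteq> monic_real_rooted n closure_of stratum L"
    using continuous_map_image_closure_subset[OF continuous_map_root_poly, of n "line_cone (delta L)" "generic L"]
    by (simp add: root_poly_generic[OF L n])
qed

section \<open>Transfer to the compactified stratum\<close>

lemma continuous_map_Alexandroff_homeomorphic:
  assumes fg: "homeomorphic_maps X Y f g"
  shows "continuous_map (Alexandroff_compactification X) (Alexandroff_compactification Y) (map_option f)"
    (is "continuous_map ?A ?B _")
  unfolding continuous_map_def
proof (intro conjI allI impI)
  have f: "continuous_map X Y f" and g: "continuous_map Y X g"
    and gf: "\<And>x. x \<in> topspace X \<Longrightarrow> g (f x) = x" and fg': "\<And>y. y \<in> topspace Y \<Longrightarrow> f (g y) = y"
    using fg by (auto simp: homeomorphic_maps_def)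
  have fX: "f x \<in> topspace Y" if "x \<in> topspace X" for x
    using f that by (auto simp: continuous_map_def)
  show "map_option f \<in> topspace ?A \<rightarrow> topspace ?B" using fX by auto
  fix V assume "openin ?B V"
  then consider U where "openin Y U" "V = Some ` U"
    | C where "compactin Y C" "closedin Y C" "V = insert None (Some ` (topspace Y - C))"
    unfolding openin_Alexandroff_compactification by blast
  then show "openin ?A {u \<in> topspace ?A. map_option f u \<in> V}"
  proof cases
    case 1
    then have "{u \<in> topspace ?A. map_option f u \<in> V} = Some ` {x \<in> topspace X. f x \<in> U}" by auto
    then show ?thesis using f 1(1) by (simp add: continuous_map_def)
  next
    case 2
    \<comment> \<open>The preimage under \<open>f\<close> is the image under the inverse
      \<open>g\<close>, hence compact. The polynomial side is an abstract topology, so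
      \<open>exhausts\<close> cannot be used for it.\<close>
    let ?C = "{x \<in> topspace X. f x \<in> C}"
    have "C \<subseteq> topspace Y" using 2(2) by (rule closedin_subset)
    have "?C = g ` C"
    proof (intro equalityI subsetI)
      fix x assume "x \<in> ?C"
      then show "x \<in> g ` C" using gf by (intro image_eqI[of _ _ "f x"]) auto
    next
      fix x assume "x \<in> g ` C"
      then obtain y where y: "y \<in> C" "x = g y" by blast
      then have "y \<in> topspace Y" using \<open>C \<subseteq> topspace Y\<close> by blast
      then show "x \<in> ?C" using g fg' y by (auto simp: continuous_map_def)
    qed
    then have "compactin X ?C" using image_compactin[OF 2(1) g] by simp
    moreover have "closedin X ?C" using f 2(2) by (rule closedin_continuous_map_preimage)
    moreover have "{u \<in> topspace ?A. map_option f u \<in> V} = insert None (Some ` (topspace X - ?C))"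
      using 2(3) fX by auto
    ultimately show ?thesis unfolding openin_Alexandroff_compactification by blast
  qed
qed

lemma homeomorphic_space_Alexandroff:
  assumes "X homeomorphic_space Y"
  shows "Alexandroff_compactification X homeomorphic_space Alexandroff_compactification Y"
proof -
  obtain f g where fg: "homeomorphic_maps X Y f g" using assms by (auto simp: homeomorphic_space_def)
  then have gf: "homeomorphic_maps Y X g f" by (rule homeomorphic_maps_sym[THEN iffD1])
  have "homeomorphic_maps (Alexandroff_compactification X) (Alexandroff_compactification Y)
      (map_option f) (map_option g)"
    using fg unfolding homeomorphic_maps_def[of "Alexandroff_compactification X"]
    by (auto simp: continuous_map_Alexandroff_homeomorphic[OF fg]
        continuous_map_Alexandroff_homeomorphic[OF gf] homeomorphic_maps_def)
  then show ?thesis by (auto simp: homeomorphic_space_def)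
qed

theorem contractible_Hyp_hat:
  assumes L: "number_partition n L" and n: "0 < n" and c: "collapsible (delta L)"
  shows "contractible_space (Hyp_hat n L)"
proof -
  have K: "finite (delta L)" "\<forall>F\<in>delta L. Pow F \<subseteq> delta L" "delta L \<subseteq> Pow {0<..<n}"
    using delta_subset[OF L] collapsible_props[OF c] by auto
  have "top_of_set (line_cone (delta L)) homeomorphic_space
      subtopology (monic_real_rooted n) (monic_real_rooted n closure_of stratum L)"
    using homeomorphic_map_root_poly[OF n K] by (auto simp: closure_of_stratum[OF L n] homeomorphic_space)
  then show ?thesis
    using homeomorphic_space_contractibility[OF homeomorphic_space_Alexandroff]
      contractible_Alexandroff_line_cone[OF c K(3)]
    by (auto simp: Hyp_hat_def)
qed

theorem theorem3p2:
  fixes n :: nat and p :: "nat list"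
  assumes "number_partition n (mset p)" and "p \<noteq> []" and "cutting_condition p"
  shows
    "((\<exists>I J. trivial_resonance p I J \<and> 0 \<in> I \<union> J) \<longrightarrow>
        topspace (geometric_realization (delta (mset p))) \<noteq> {} \<and>
        contractible_space (geometric_realization (delta (mset p))) \<and>
        contractible_space (Hyp_hat n (mset p))) \<and>
     ((\<forall>i\<in>{1..<length p}. p ! 0 \<noteq> p ! i) \<longrightarrow>
        (\<exists>M. acyclic_matching (D_poset (mset p)) comp_le M \<and>
           critical_cells (D_poset (mset p)) M =
             {a \<in> D_poset (mset p). last a = p ! 0 \<and>
                (\<forall>i<length a - 1. \<forall>I\<subseteq>{1..<length p}. a ! i \<noteq> p ! 0 + (\<Sum>j\<in>I. p ! j))}))"
proof -
  interpret cutting n p using assms by unfold_locales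
  have B: "(\<forall>I\<subseteq>{1..<length p}. m \<noteq> p ! 0 + (\<Sum>j\<in>I. p ! j)) \<longleftrightarrow> m \<notin> (+) (p ! 0) ` B" for m
    by (auto simp: B_def)
  show ?thesis
  proof (intro conjI impI)
    assume "\<exists>I J. trivial_resonance p I J \<and> 0 \<in> I \<union> J"
    then obtain I J where IJ: "resonance p I J" "card I = 1" "card J = 1" "0 \<in> I \<union> J"
      by (auto simp: trivial_resonance_def)
    then obtain i j where "I = {i}" "J = {j}" by (auto simp: card_1_singleton_iff)
    \<comment> \<open>One of the two singletons is \<open>{0}\<close>; by disjointness the other
      holds a positive index with the same part.\<close>
    then have "\<exists>k\<in>{1..<length p}. p ! k = p ! 0"
      using IJ(1,4) by (auto simp: resonance_def intro: bexI[of _ i] bexI[of _ j])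
    then have c: "collapsible (delta (mset p))" using collapsible_delta by blast
    show "topspace (geometric_realization (delta (mset p))) \<noteq> {}"
      "contractible_space (geometric_realization (delta (mset p)))"
      using contractible_geometric_realization[OF c K_sub] by blast+
    show "contractible_space (Hyp_hat n (mset p))"
      by (rule contractible_Hyp_hat[OF part n_pos c])
  next
    show "\<exists>M. acyclic_matching (D_poset (mset p)) comp_le M \<and>
      critical_cells (D_poset (mset p)) M =
        {a \<in> D_poset (mset p). last a = p ! 0 \<and>
          (\<forall>i<length a - 1. \<forall>I\<subseteq>{1..<length p}. a ! i \<noteq> p ! 0 + (\<Sum>j\<in>I. p ! j))}"
      unfolding B using acyclic_matching_D_poset by blast
  qed
qed

end
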